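(* Let $T=(V,E)$ be a finite tree that is not a star, with an initial metric in $\mathbb{R}_{>0}^{E}$. Then: (a) If the normalized Ricci flow converges to a metric with constant curvature zero, then $T$ is a caterpillar tree, i.e. $T$ can be obtained from a path $P=v_1-v_2-\cdots-v_n$ by adding pendant vertices in such a way that (1) the terminal vertex $v_1$ (resp. $v_n$) is adjacent to $d_{v_1}-1$ (resp. $d_{v_n}-1$) leaves, and (2) for every other vertex $v_i$ of $P$, either $d_{v_i}=2$ or $v_i$ is adjacent to $d_{v_i}-2$ leaves. (b) For caterpillar trees, the limit as $t\to\infty$ of the unnormalized weight of an edge can be $0$, can be $\infty$, or can be another finite value, which can be influenced by the initial metric (that is, each of the three possibilities occurs for some caterpillar tree, some initial metric and some edge, and there are a caterpillar tree and an edge for which different initial metrics give different finite positive limits). For every caterpillar tree, every initial metric and every leaf edge $e$, the normalized weight of $e$ tends to $0$ as $t\to\infty$. (c) If $T$ is not a caterpillar tree, then there is an edge of $T$ whose unnormalized weight increases to $\infty$ as $t\to\infty$.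
   Context: Trees are finite and connected; $d_u$ is the degree of $u$. A star is a tree with a vertex adjacent to all the others (including the trees with at most three vertices). Leaf edge: an edge with an endpoint of degree $1$. For a metric $w\in\mathbb{R}_{>0}^{E}$, let $d(x,y)$ be the weighted path distance and $D_x=\sum_{z\sim x}1/w_{xz}$. The curvature is the Lin-Lu-Yau version of Ollivier Ricci curvature with parameter function $\gamma(x)=1/x$: let $\mu_x^\alpha$ be the probability measure with $\mu_x^\alpha(x)=\alpha$, $\mu_x^\alpha(y)=(1-\alpha)\frac{1/w_{xy}}{D_x}$ for $y\sim x$, and $0$ otherwise; with $W$ the $L^1$ transportation distance for $d$, set $\kappa_\alpha(x,y)=1-W(\mu_x^\alpha,\mu_y^\alpha)/d(x,y)$ and $\kappa_{xy}=\lim_{\alpha\to1}\kappa_\alpha(x,y)/(1-\alpha)$. On a tree, for an edge $uv$, $$\kappa_{uv}=\frac{2-d_u}{w_{uv}D_u}+\frac{2-d_v}{w_{uv}D_v}.$$ Unnormalized Ricci flow: $\frac{d}{dt}\tilde w_e=-\kappa_e\tilde w_e$ for all $e\in E$. Normalized Ricci flow (initial weights of total sum $1$): $\frac{d}{dt}w_e=-\kappa_e w_e+w_e\sum_{h\in E}\kappa_h w_h$. Both have unique positive solutions for all $t\ge0$, related by $w_e(t)=\tilde w_e(t)/\sum_{h\in E}\tilde w_h(t)$. "Unnormalized weight" means $\tilde w$, "normalized weight" means $w$. The normalized Ricci flow converges to a metric with constant curvature $\tau$ if there is $w(\infty)\in\mathbb{R}_{\ge0}^{E}$ with $\lim_{t\to\infty}w(t)=w(\infty)$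 such that, under $w(\infty)$, the curvature of each edge in $E^+=\{e\in E: w_e(\infty)>0\}$ equals $\tau$. Here the curvature formula is used for edges $uv\in E^+$ with the convention that $D_u=\infty$, and $\frac{2-d_u}{w_{uv}D_u}=0$, if some edge at $u$ has weight $0$. *)

theory Defs
  imports "HOL-Analysis.Analysis"
begin

section \<open>Finite trees\<close>

text \<open>
  A simple graph is given by a vertex set and a set of two-element vertex sets. Paths are
  nonempty lists of pairwise distinct vertices in which consecutive vertices are adjacent.
\<close>

definition graph_path :: "'a set \<Rightarrow> 'a set set \<Rightarrow> 'a list \<Rightarrow> bool" where
  "graph_path V E p \<longleftrightarrow>
     p \<noteq> [] \<and> set p \<subseteq> V \<and> distinct p \<and> successively (\<lambda>x y. {x, y} \<in> E) p"

definition graph_path_between :: "'a set \<Rightarrow> 'a set set \<Rightarrow> 'a \<Rightarrow> 'a list \<Rightarrow> 'a \<Rightarrow> bool" where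
  "graph_path_between V E x p y \<longleftrightarrow> graph_path V E p \<and> hd p = x \<and> last p = y"

definition finite_tree :: "'a set \<Rightarrow> 'a set set \<Rightarrow> bool" where
  "finite_tree V E \<longleftrightarrow>
     finite V \<and> V \<noteq> {} \<and>
     (\<forall>e\<in>E. e \<subseteq> V \<and> card e = 2) \<and>
     (\<forall>x\<in>V. \<forall>y\<in>V. \<exists>p. graph_path_between V E x p y) \<and>
     \<not> (\<exists>p. graph_path V E p \<and> length p \<ge> 3 \<and> {last p, hd p} \<in> E)"

definition nbrs :: "'a set set \<Rightarrow> 'a \<Rightarrow> 'a set" where
  "nbrs E x = {z. {x, z} \<in> E}"

definition deg :: "'a set set \<Rightarrow> 'a \<Rightarrow> nat" where
  "deg E x = card (nbrs E x)"

definition is_star :: "'a set \<Rightarrow> 'a set set \<Rightarrow> bool" where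
  "is_star V E \<longleftrightarrow> finite_tree V E \<and> (\<exists>c\<in>V. \<forall>x\<in>V - {c}. {c, x} \<in> E)"

definition leaf_edge :: "'a set set \<Rightarrow> 'a set \<Rightarrow> bool" where
  "leaf_edge E e \<longleftrightarrow> e \<in> E \<and> (\<exists>x\<in>e. deg E x = 1)"

definition leaf_nbrs :: "'a set set \<Rightarrow> 'a \<Rightarrow> 'a set" where
  "leaf_nbrs E x = {z \<in> nbrs E x. deg E z = 1}"

text \<open>
  The list \<open>p\<close> is the path \<open>v\<^sub>1, \<dots>, v\<^sub>n\<close>. The conditions \<open>#leaves = d - 1\<close> and
  \<open>#leaves = d - 2\<close> are written additively, because subtraction on \<^typ>\<open>nat\<close> truncates.
\<close>

definition caterpillar :: "'a set \<Rightarrow> 'a set set \<Rightarrow> bool" where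
  "caterpillar V E \<longleftrightarrow>
     finite_tree V E \<and>
     (\<exists>p. graph_path V E p \<and>
        (\<forall>x\<in>V - set p. deg E x = 1 \<and> (\<exists>v\<in>set p. {v, x} \<in> E)) \<and>
        (\<forall>v\<in>{hd p, last p}. card (leaf_nbrs E v) + 1 = deg E v) \<and>
        (\<forall>v\<in>set p - {hd p, last p}. deg E v = 2 \<or> card (leaf_nbrs E v) + 2 = deg E v))"


section \<open>Lin-Lu-Yau curvature of a weighted graph\<close>

text \<open>
  Edge weights are functions on all sets, but only their values on \<open>E\<close> matter.
\<close>

definition edge_metric :: "'a set set \<Rightarrow> ('a set \<Rightarrow> real) \<Rightarrow> bool" where
  "edge_metric E w \<longleftrightarrow> (\<forall>e\<in>E. w e > 0)"

definition path_weight :: "('a set \<Rightarrow> real) \<Rightarrow> 'a list \<Rightarrow> real" where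
  "path_weight w p = (\<Sum>(x, y)\<leftarrow>zip p (tl p). w {x, y})"

definition path_dist :: "'a set \<Rightarrow> 'a set set \<Rightarrow> ('a set \<Rightarrow> real) \<Rightarrow> 'a \<Rightarrow> 'a \<Rightarrow> real" where
  "path_dist V E w x y = Inf {path_weight w p |p. graph_path_between V E x p y}"

definition inv_weight_sum :: "'a set set \<Rightarrow> ('a set \<Rightarrow> real) \<Rightarrow> 'a \<Rightarrow> real" where
  "inv_weight_sum E w x = (\<Sum>z\<in>nbrs E x. 1 / w {x, z})"

definition lazy_measure ::
  "'a set set \<Rightarrow> ('a set \<Rightarrow> real) \<Rightarrow> real \<Rightarrow> 'a \<Rightarrow> 'a \<Rightarrow> real" where
  "lazy_measure E w \<alpha> x y =
     (if y = x then \<alpha>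
      else if y \<in> nbrs E x then (1 - \<alpha>) * ((1 / w {x, y}) / inv_weight_sum E w x)
      else 0)"

definition coupling :: "'a set \<Rightarrow> ('a \<Rightarrow> real) \<Rightarrow> ('a \<Rightarrow> real) \<Rightarrow> ('a \<Rightarrow> 'a \<Rightarrow> real) \<Rightarrow> bool" where
  "coupling V m n q \<longleftrightarrow>
     (\<forall>x\<in>V. \<forall>y\<in>V. q x y \<ge> 0) \<and>
     (\<forall>x\<in>V. (\<Sum>y\<in>V. q x y) = m x) \<and>
     (\<forall>y\<in>V. (\<Sum>x\<in>V. q x y) = n y)"

definition transport_dist ::
  "'a set \<Rightarrow> ('a \<Rightarrow> 'a \<Rightarrow> real) \<Rightarrow> ('a \<Rightarrow> real) \<Rightarrow> ('a \<Rightarrow> real) \<Rightarrow> real" where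
  "transport_dist V d m n = Inf {(\<Sum>x\<in>V. \<Sum>y\<in>V. q x y * d x y) |q. coupling V m n q}"

definition lazy_curvature ::
  "'a set \<Rightarrow> 'a set set \<Rightarrow> ('a set \<Rightarrow> real) \<Rightarrow> real \<Rightarrow> 'a \<Rightarrow> 'a \<Rightarrow> real" where
  "lazy_curvature V E w \<alpha> x y =
     1 - transport_dist V (path_dist V E w) (lazy_measure E w \<alpha> x) (lazy_measure E w \<alpha> y)
           / path_dist V E w x y"

definition lly_curvature ::
  "'a set \<Rightarrow> 'a set set \<Rightarrow> ('a set \<Rightarrow> real) \<Rightarrow> 'a \<Rightarrow> 'a \<Rightarrow> real" where
  "lly_curvature V E w x y = Lim (at_left 1) (\<lambda>\<alpha>. lazy_curvature V E w \<alpha> x y / (1 - \<alpha>))"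

text \<open>
  The curvature of an edge does not depend on the order of its endpoints; this is shown below
  and justifies the definite description.
\<close>

definition edge_curvature :: "'a set \<Rightarrow> 'a set set \<Rightarrow> ('a set \<Rightarrow> real) \<Rightarrow> 'a set \<Rightarrow> real" where
  "edge_curvature V E w e = (THE k. \<exists>x y. e = {x, y} \<and> k = lly_curvature V E w x y)"

lemma path_weight_rev: "path_weight w (rev p) = path_weight w p"
proof (induction p)
  case (Cons a p)
  have snoc: "path_weight w (q @ [a]) = path_weight w q + (if q = [] then 0 else w {last q, a})"
    for q
  proof (induction q)
    case (Cons b q)
    then show ?case by (cases q) (auto simp: path_weight_def)
  qed (simp add: path_weight_def)
  have cons: "path_weight w (a # p) = path_weight w p + (if p = [] then 0 else w {hd p, a})"
    by (cases p) (auto simp: path_weight_def insert_commute)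
  show ?case
    using Cons by (simp add: snoc cons last_rev)
qed (simp add: path_weight_def)

lemma graph_path_between_rev:
  assumes "graph_path_between V E x p y"
  shows "graph_path_between V E y (rev p) x"
  using assms unfolding graph_path_between_def graph_path_def
  by (auto simp: hd_rev last_rev insert_commute)

lemma path_dist_commute: "path_dist V E w x y = path_dist V E w y x"
proof -
  have "{path_weight w p |p. graph_path_between V E x p y} \<subseteq>
        {path_weight w p |p. graph_path_between V E y p x}" for x y
    using graph_path_between_rev[of V E x _ y] path_weight_rev[of w, symmetric] by blast
  from this[of x y] this[of y x] show ?thesis
    unfolding path_dist_def by (simp add: subset_antisym)
qed

lemma transport_dist_commute:
  assumes "\<And>x y. d x y = d y x"
  shows "transport_dist V d m n = transport_dist V d n m"
proof -
  have "{(\<Sum>x\<in>V. \<Sum>y\<in>V. q x y * d x y) |q. coupling V m n q} \<subseteq>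
        {(\<Sum>x\<in>V. \<Sum>y\<in>V. q x y * d x y) |q. coupling V n m q}" for m n
  proof clarify
    fix q assume q: "coupling V m n q"
    have "(\<Sum>x\<in>V. \<Sum>y\<in>V. q x y * d x y) = (\<Sum>x\<in>V. \<Sum>y\<in>V. q y x * d x y)"
      by (subst sum.swap) (simp add: assms)
    moreover have "coupling V n m (\<lambda>x y. q y x)"
      using q by (auto simp: coupling_def)
    ultimately show "\<exists>q'. (\<Sum>x\<in>V. \<Sum>y\<in>V. q x y * d x y) = (\<Sum>x\<in>V. \<Sum>y\<in>V. q' x y * d x y)
                       \<and> coupling V n m q'"
      by (intro exI[of _ "\<lambda>x y. q y x"] conjI) auto
  qed
  from this[of m n] this[of n m] show ?thesis
    unfolding transport_dist_def by (simp add: subset_antisym)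
qed

lemma lly_curvature_commute: "lly_curvature V E w x y = lly_curvature V E w y x"
  unfolding lly_curvature_def lazy_curvature_def
  by (subst path_dist_commute, subst transport_dist_commute[OF path_dist_commute]) (rule refl)

lemma edge_curvature_doubleton: "edge_curvature V E w {x, y} = lly_curvature V E w x y"
  unfolding edge_curvature_def
  by (rule the_equality) (auto simp: doubleton_eq_iff intro: lly_curvature_commute)


section \<open>Ricci flows\<close>

text \<open>
  A flow is a positive solution on \<open>[0, \<infinity>)\<close>; at \<open>t = 0\<close> the derivative is one-sided.
\<close>

definition unnormalized_ricci_flow ::
  "'a set \<Rightarrow> 'a set set \<Rightarrow> ('a set \<Rightarrow> real) \<Rightarrow> (real \<Rightarrow> 'a set \<Rightarrow> real) \<Rightarrow> bool" where
  "unnormalized_ricci_flow V E w0 w \<longleftrightarrow>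
     (\<forall>e\<in>E. w 0 e = w0 e) \<and>
     (\<forall>t\<ge>0. \<forall>e\<in>E. w t e > 0) \<and>
     (\<forall>t\<ge>0. \<forall>e\<in>E. ((\<lambda>s. w s e) has_real_derivative
        - edge_curvature V E (w t) e * w t e) (at t within {0..}))"

text \<open>
  The normalized flow starts from the initial metric rescaled to total weight \<open>1\<close>.
\<close>

definition normalized_ricci_flow ::
  "'a set \<Rightarrow> 'a set set \<Rightarrow> ('a set \<Rightarrow> real) \<Rightarrow> (real \<Rightarrow> 'a set \<Rightarrow> real) \<Rightarrow> bool" where
  "normalized_ricci_flow V E w0 w \<longleftrightarrow>
     (\<forall>e\<in>E. w 0 e = w0 e / (\<Sum>h\<in>E. w0 h)) \<and>
     (\<forall>t\<ge>0. \<forall>e\<in>E. w t e > 0) \<and>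
     (\<forall>t\<ge>0. \<forall>e\<in>E. ((\<lambda>s. w s e) has_real_derivative
        - edge_curvature V E (w t) e * w t e
        + w t e * (\<Sum>h\<in>E. edge_curvature V E (w t) h * w t h)) (at t within {0..}))"

text \<open>
  The limit of the flow may have edges of weight \<open>0\<close>. On its edges of positive weight, the
  curvature is the one given by the formula for trees, where the contribution of an endpoint
  that is incident to an edge of weight \<open>0\<close> vanishes.
\<close>

definition limit_curvature_term :: "'a set set \<Rightarrow> ('a set \<Rightarrow> real) \<Rightarrow> 'a set \<Rightarrow> 'a \<Rightarrow> real" where
  "limit_curvature_term E w e u =
     (if \<exists>h\<in>E. u \<in> h \<and> w h = 0 then 0
      else (2 - real (deg E u)) / (w e * inv_weight_sum E w u))"

definition limit_curvature :: "'a set set \<Rightarrow> ('a set \<Rightarrow> real) \<Rightarrow> 'a set \<Rightarrow> real" where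
  "limit_curvature E w e = (\<Sum>u\<in>e. limit_curvature_term E w e u)"

definition converges_to_constant_curvature ::
  "'a set set \<Rightarrow> (real \<Rightarrow> 'a set \<Rightarrow> real) \<Rightarrow> real \<Rightarrow> bool" where
  "converges_to_constant_curvature E w \<tau> \<longleftrightarrow>
     (\<exists>winf. (\<forall>e\<in>E. winf e \<ge> 0) \<and>
        (\<forall>e\<in>E. ((\<lambda>t. w t e) \<longlongrightarrow> winf e) at_top) \<and>
        (\<forall>e\<in>E. winf e > 0 \<longrightarrow> limit_curvature E winf e = \<tau>))"

end

theory Submission
  imports Defs
begin

text \<open>
  On a tree a single Lipschitz function, together with a coupling that is tight for it, computes
  the transportation distance, and the unnormalized flow becomes
  \<open>w\<^bsub>uv\<^esub>' = (d\<^sub>u - 2) / D\<^sub>u + (d\<^sub>v - 2) / D\<^sub>v\<close>; the normalized flow has an additional term \<open>r w\<close>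
  with the same \<open>r\<close> for all edges.

  A tree that is not a star is a caterpillar iff every vertex has at most two neighbours that are
  not leaves. If \<open>c\<close> has \<open>k \<ge> 3\<close> such neighbours, the product of the weights at \<open>c\<close> has
  logarithmic derivative at least \<open>k - 2 + d\<^sub>c r\<close>. This is impossible for bounded weights if
  \<open>r \<longrightarrow> 0\<close>, which is the case for a limit of curvature zero (a). In the unnormalized flow (\<open>r = 0\<close>) it
  makes some edge at \<open>c\<close> unbounded, and then also an edge without a leaf, because the weights of
  leaf edges at \<open>c\<close> grow less than the weights of the other ones (c). In a caterpillar, the ratio \<open>R\<close>
  of the weight of all leaf edges at a vertex to the weight of a non-leaf edge satisfies
  \<open>R' \<le> - R\<^sup>2 / (l\<^sup>2 + R)\<close> with \<open>l\<close> the number of leaves (b).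
\<close>

section \<open>Trees and caterpillars\<close>

lemma successively_append_hd_last:
  "successively P (xs @ ys) \<longleftrightarrow> successively P xs \<and> successively P ys \<and>
     (xs = [] \<or> ys = [] \<or> P (last xs) (hd ys))"
  by (auto simp: successively_append_iff)

lemma graph_path_rev: "graph_path V E p \<Longrightarrow> graph_path V E (rev p)"
  unfolding graph_path_def by (auto simp: insert_commute)

lemma graph_path_appendD1:
  assumes "graph_path V E (p @ q)" "p \<noteq> []"
  shows "graph_path V E p"
  using assms unfolding graph_path_def by (auto simp: successively_append_hd_last)

text \<open>Cutting the cycle open at \<open>x\<close> leaves the list \<open>b @ a\<close>, whose
  two ends are adjacent to \<open>x\<close> and differ by distinctness. It serves to show that a
  newly attached leaf lies on no cycle.\<close>

lemma cycle_nbrs: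
  assumes p: "graph_path V E p" "length p \<ge> 3" "{last p, hd p} \<in> E" and x: "x \<in> set p"
  shows "\<exists>y z. y \<noteq> z \<and> y \<in> nbrs E x \<and> z \<in> nbrs E x"
proof -
  obtain a b where ab: "p = a @ x # b"
    using x by (meson split_list)
  have dist: "distinct (b @ a)" and succ: "successively (\<lambda>x y. {x, y} \<in> E) (a @ x # b)"
    using p ab by (auto simp: graph_path_def)
  have len: "length (b @ a) \<ge> 2"
    using p ab by simp
  have "hd (b @ a) \<noteq> last (b @ a)"
    using dist len by (cases "b @ a") auto
  \<comment> \<open>If \<open>b\<close> is empty, then \<open>x\<close> is the last vertex of
    \<open>p\<close>, and the closing edge \<open>{last p, hd p}\<close> supplies this neighbour;
    the case of empty \<open>a\<close> below is symmetric.\<close>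
  moreover have "hd (b @ a) \<in> nbrs E x"
    using p(3) succ ab len
    by (cases b) (auto simp: nbrs_def successively_append_hd_last insert_commute hd_append split: if_splits)
  moreover have "last (b @ a) \<in> nbrs E x"
    using p(3) succ ab len
    by (cases "a = []") (auto simp: nbrs_def successively_append_hd_last insert_commute last_append split: if_splits)
  ultimately show ?thesis by blast
qed

locale tree_graph =
  fixes V :: "'a set" and E :: "'a set set"
  assumes tree: "finite_tree V E"
begin

lemma finite_V: "finite V" and V_nonempty: "V \<noteq> {}"
  using tree by (auto simp: finite_tree_def)

lemma edgeD:
  assumes "{x, y} \<in> E"
  shows "x \<in> V" "y \<in> V" "x \<noteq> y"
proof -
  have "{x, y} \<subseteq> V" "card {x, y} = 2"
    using assms tree unfolding finite_tree_def by blast+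
  then show "x \<in> V" "y \<in> V" "x \<noteq> y" by auto
qed

lemma edge_cases:
  assumes "e \<in> E"
  obtains x y where "e = {x, y}" "x \<noteq> y" "x \<in> V" "y \<in> V"
  using assms tree that unfolding finite_tree_def by (metis card_2_iff insert_subset)

lemma finite_E: "finite E"
proof (rule finite_subset)
  show "E \<subseteq> Pow V" using tree by (auto simp: finite_tree_def)
qed (simp add: finite_V)

lemma nbrs_subset: "nbrs E x \<subseteq> V"
  using edgeD by (auto simp: nbrs_def)

lemma finite_nbrs: "finite (nbrs E x)"
  using nbrs_subset finite_V finite_subset by blast

lemma not_self_nbr: "x \<notin> nbrs E x"
  using edgeD[of x x] by (auto simp: nbrs_def)

lemma connected: "x \<in> V \<Longrightarrow> y \<in> V \<Longrightarrow> \<exists>p. graph_path_between V E x p y"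
  using tree by (auto simp: finite_tree_def)

lemma acyclic: "graph_path V E p \<Longrightarrow> length p \<ge> 3 \<Longrightarrow> {last p, hd p} \<notin> E"
  using tree by (auto simp: finite_tree_def)

text \<open>Induction along the first path: if the two paths leave \<open>x\<close> by different
  edges, following one until it first meets the other and returning along the other gives a
  cycle.\<close>

lemma path_unique:
  assumes "graph_path_between V E x p y" "graph_path_between V E x q y"
  shows "p = q"
  using assms
proof (induction p arbitrary: x q)
  case Nil
  then show ?case by (auto simp: graph_path_between_def graph_path_def)
next
  case (Cons a p)
  then have [simp]: "a = x" by (simp add: graph_path_between_def)
  obtain q' where q: "q = x # q'"
    using Cons.prems(2) by (cases q) (auto simp: graph_path_between_def graph_path_def)
  have dp: "distinct (x # p)" "last (x # p) = y" and sp: "successively (\<lambda>x y. {x, y} \<in> E) (x # p)"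
    and Vp: "set (x # p) \<subseteq> V"
    using Cons.prems(1) by (auto simp: graph_path_between_def graph_path_def)
  have dq: "distinct (x # q')" "last (x # q') = y"
    and sq: "successively (\<lambda>x y. {x, y} \<in> E) (x # q')" and Vq: "set (x # q') \<subseteq> V"
    using Cons.prems(2) q by (auto simp: graph_path_between_def graph_path_def)
  show ?case
  \<comment> \<open>If one path is the single vertex \<open>x\<close>, then \<open>y = x\<close>,
    and distinctness makes the other path a single vertex as well.\<close>
  proof (cases "p = [] \<or> q' = []")
    case True
    then show ?thesis using dp dq q by (cases p; cases q') (auto split: if_splits)
  next
    case False
    then have ne: "p \<noteq> []" "q' \<noteq> []" by auto
    have gp: "graph_path_between V E (hd p) p y" "graph_path_between V E (hd q') q' y"
      using ne dp dq sp sq Vp Vq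
      by (auto simp: graph_path_between_def graph_path_def successively_Cons)
    have "hd p = hd q'"
    proof (rule ccontr)
      assume neq: "hd p \<noteq> hd q'"
      have "\<exists>z\<in>set p. z \<in> set q'"
        using ne dp dq by (metis last_ConsR last_in_set)
      then obtain as z bs where p: "p = as @ z # bs" and z: "z \<in> set q'"
        and as: "\<forall>v\<in>set as. v \<notin> set q'"
        using split_list_first_prop[of p "\<lambda>z. z \<in> set q'"] by blast
      obtain cs ds where q': "q' = cs @ z # ds"
        using z by (meson split_list)
      \<comment> \<open>The cycle: from \<open>x\<close> along \<open>p\<close> to the meeting point
        \<open>z\<close>, then back along \<open>q'\<close> to \<open>hd q'\<close>, a neighbour of
        \<open>x\<close>. Were \<open>as\<close> and \<open>cs\<close> both empty, \<open>z\<close>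
        would be the head of both \<open>p\<close> and \<open>q'\<close>.\<close>
      define c where "c = (x # as @ [z]) @ rev cs"
      have l: "length c \<ge> 3"
        using neq by (cases as; cases cs) (auto simp: p q' c_def)
      have d: "distinct c"
        using dp dq as by (auto simp: c_def p q')
      have sas: "successively (\<lambda>x y. {x, y} \<in> E) (x # as @ [z])"
        using sp unfolding p
        by (metis append_Cons append_assoc append_Nil successively_append_hd_last)
      have sc: "successively (\<lambda>x y. {x, y} \<in> E) (cs @ [z])"
        using sq successively_append_hd_last[of _ "x # cs @ [z]" ds]
        by (auto simp: q' successively_Cons)
      have "successively (\<lambda>x y. {x, y} \<in> E) c"
        using sas sc unfolding c_def successively_append_hd_last
        by (auto simp: hd_rev insert_commute)
      then have gpc: "graph_path V E c"
        using d Vp Vq by (auto simp: graph_path_def c_def p q')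
      have "last c = hd q'"
        by (cases cs) (auto simp: c_def q')
      moreover have "hd c = x" by (simp add: c_def)
      moreover have "{x, hd q'} \<in> E"
        using sq ne by (auto simp: successively_Cons)
      ultimately show False
        using acyclic[OF gpc l] by (simp add: insert_commute)
    qed
    then have "p = q'"
      using Cons.IH[OF gp(1)] gp(2) by simp
    then show ?thesis using q by simp
  qed
qed

lemma path_dist_path:
  assumes "graph_path_between V E x p y"
  shows "path_dist V E w x y = path_weight w p"
proof -
  have "{path_weight w q |q. graph_path_between V E x q y} = {path_weight w p}"
    using path_unique[OF assms] assms by blast
  then show ?thesis by (simp add: path_dist_def)
qed

lemma no_triangle:
  assumes "{x, y} \<in> E" "{y, z} \<in> E"
  shows "{x, z} \<notin> E"
proof
  assume "{x, z} \<in> E"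
  with assms edgeD[of x y] edgeD[of y z] edgeD[of x z] acyclic[of "[x, y, z]"]
  show False by (simp add: graph_path_def insert_commute[of z x])
qed

section \<open>Leaves, inner neighbours and the characterization of caterpillars\<close>

lemma deg_le_one:
  assumes "deg E x = 1" "y \<in> nbrs E x"
  shows "nbrs E x = {y}"
  using assms by (auto simp: deg_def card_1_singleton_iff)

lemma deg_ge_two:
  assumes "y \<in> nbrs E x" "deg E x \<noteq> 1"
  shows "deg E x \<ge> 2"
proof -
  have "deg E x \<noteq> 0"
    using assms finite_nbrs by (auto simp: deg_def)
  then show ?thesis using assms(2) by linarith
qed

text \<open>The predecessor and the successor of \<open>x\<close> on the path are two different
  neighbours.\<close>

lemma path_inner_not_leaf:
  assumes "graph_path V E (a @ x # b)" "a \<noteq> []" "b \<noteq> []"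
  shows "deg E x \<noteq> 1"
proof
  assume d: "deg E x = 1"
  have "last a \<in> nbrs E x" "hd b \<in> nbrs E x"
    using assms by (auto simp: graph_path_def nbrs_def successively_append_hd_last
        successively_Cons insert_commute)
  moreover have "last a \<noteq> hd b"
    using assms by (auto simp: graph_path_def) (metis assms(2,3) disjoint_iff hd_in_set last_in_set)
  ultimately show False using deg_le_one[OF d] by blast
qed

definition inner_nbrs :: "'a \<Rightarrow> 'a set" where
  "inner_nbrs x = {z \<in> nbrs E x. deg E z \<noteq> 1}"

lemma finite_inner_nbrs: "finite (inner_nbrs x)" and finite_leaf_nbrs: "finite (leaf_nbrs E x)"
  using finite_nbrs by (auto simp: inner_nbrs_def leaf_nbrs_def)

lemma nbrs_split:
  "nbrs E x = leaf_nbrs E x \<union> inner_nbrs x" "leaf_nbrs E x \<inter> inner_nbrs x = {}"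
  by (auto simp: inner_nbrs_def leaf_nbrs_def)

lemma deg_split: "deg E x = card (leaf_nbrs E x) + card (inner_nbrs x)"
  using card_Un_disjoint[OF finite_leaf_nbrs finite_inner_nbrs nbrs_split(2)]
  by (simp add: deg_def flip: nbrs_split(1))

text \<open>The second vertex of a path starting at \<open>v\<close> is a leaf by assumption, and a
  leaf cannot be passed through, so every path from \<open>v\<close> has at most one edge.\<close>

lemma star_if_no_inner_nbrs:
  assumes v: "v \<in> V" and no: "inner_nbrs v = {}"
  shows "is_star V E"
proof -
  have "{v, y} \<in> E" if y: "y \<in> V - {v}" for y
  proof -
    obtain p where p: "graph_path_between V E v p y"
      using connected v y by blast
    then obtain z q where q: "p = v # z # q"
      using y by (cases p; cases "tl p") (auto simp: graph_path_between_def graph_path_def)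
    have gp: "graph_path V E ([v] @ z # q)"
      using p q by (simp add: graph_path_between_def)
    have vz: "z \<in> nbrs E v"
      using gp by (auto simp: graph_path_def nbrs_def)
    have "q = []"
      using path_inner_not_leaf[OF gp] no vz by (auto simp: inner_nbrs_def)
    then show ?thesis
      using p q vz by (auto simp: graph_path_between_def nbrs_def)
  qed
  then show ?thesis using v tree by (auto simp: is_star_def)
qed

text \<open>A neighbour of the head that occurs later on the path would close a cycle.\<close>

lemma path_hd_nbr_unique:
  assumes p: "graph_path V E (x # y # q)" and z: "z \<in> nbrs E x" "z \<in> set (x # y # q)"
  shows "z = y"
proof -
  obtain a b where ab: "x # y # q = a @ z # b"
    using z(2) by (meson split_list)
  have gp: "graph_path V E (a @ [z])"
    using p ab graph_path_appendD1[of V E "a @ [z]" b] by simp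
  have "a \<noteq> []"
    using z not_self_nbr ab by (cases a) auto
  then have hd: "hd (a @ [z]) = x" using ab by (cases a) auto
  have "\<not> length (a @ [z]) \<ge> 3"
    using acyclic[OF gp] z hd by (auto simp: nbrs_def insert_commute)
  then have "length a = 1" using \<open>a \<noteq> []\<close> by (cases a; cases "tl a") auto
  then show ?thesis using ab by (auto simp: length_Suc_conv)
qed

lemma caterpillar_inner_nbrs:
  assumes "caterpillar V E" "v \<in> V"
  shows "card (inner_nbrs v) \<le> 2"
proof -
  from assms(1) obtain p where
    p: "\<forall>x\<in>V - set p. deg E x = 1 \<and> (\<exists>v\<in>set p. {v, x} \<in> E)"
       "\<forall>v\<in>{hd p, last p}. card (leaf_nbrs E v) + 1 = deg E v"
       "\<forall>v\<in>set p - {hd p, last p}. deg E v = 2 \<or> card (leaf_nbrs E v) + 2 = deg E v"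
    unfolding caterpillar_def by (elim conjE exE)
  have "deg E v = 1 \<or> card (leaf_nbrs E v) + 1 = deg E v \<or> deg E v = 2 \<or> card (leaf_nbrs E v) + 2 = deg E v"
    using p assms(2) by blast
  then show ?thesis
    using deg_split[of v] by linarith
qed

text \<open>The spine is a longest path without leaves. Maximality at its ends, and the bound of two
  inner neighbours elsewhere, show that all inner neighbours of spine vertices lie on the spine; by
  connectedness only leaves attached to the spine remain.\<close>

lemma caterpillarI:
  assumes not_star: "\<not> is_star V E" and le2: "\<And>v. v \<in> V \<Longrightarrow> card (inner_nbrs v) \<le> 2"
  shows "caterpillar V E"
proof -
  define paths where "paths = {p. graph_path V E p \<and> (\<forall>x\<in>set p. deg E x \<noteq> 1)}"
  have len: "length p \<le> card V" if "p \<in> paths" for p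
    using that finite_V by (auto simp: paths_def graph_path_def) (metis card_mono distinct_card)
  \<comment> \<open>In a tree that is not a star every vertex has an inner neighbour. Using this
    twice gives a leafless path with two vertices, so the longest one has two different
    ends.\<close>
  obtain v0 where v0: "v0 \<in> V" using V_nonempty by blast
  then obtain u where u: "u \<in> inner_nbrs v0"
    using star_if_no_inner_nbrs not_star by blast
  then have uV: "u \<in> V" using nbrs_subset by (auto simp: inner_nbrs_def)
  then obtain v where v: "v \<in> inner_nbrs u"
    using star_if_no_inner_nbrs not_star by blast
  have uv: "[u, v] \<in> paths"
    using u v edgeD[of u v] by (auto simp: paths_def graph_path_def inner_nbrs_def nbrs_def)
  obtain p where p: "p \<in> paths" and max: "\<And>q. q \<in> paths \<Longrightarrow> length q \<le> length p"
    using ex_has_greatest_nat[of "\<lambda>p. p \<in> paths" "[u, v]" length "Suc (card V)"] uv len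
    by (metis le_imp_less_Suc)
  have gp: "graph_path V E p" and nl: "\<And>x. x \<in> set p \<Longrightarrow> deg E x \<noteq> 1"
    using p by (auto simp: paths_def)
  have pV: "set p \<subseteq> V" using gp by (auto simp: graph_path_def)
  have len2: "length p \<ge> 2" using max[OF uv] by simp
  \<comment> \<open>Stated for \<open>p\<close> and \<open>rev p\<close> in order to treat both ends
    at once. An inner neighbour of the head off the path would prolong it.\<close>
  have end1: "inner_nbrs (hd q) \<subseteq> set q \<and> card (inner_nbrs (hd q)) = 1"
    if q: "q = p \<or> q = rev p" for q
  proof -
    have gq: "graph_path V E q" and nlq: "\<forall>x\<in>set q. deg E x \<noteq> 1" and lq: "length q = length p"
      using q gp nl graph_path_rev by auto
    then obtain a b r where r: "q = a # b # r"
      using len2 by (cases q; cases "tl q") auto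
    have "inner_nbrs a = {b}"
    proof
      show "{b} \<subseteq> inner_nbrs a"
        using gq nlq r by (auto simp: inner_nbrs_def nbrs_def graph_path_def)
      show "inner_nbrs a \<subseteq> {b}"
      proof
        fix z assume z: "z \<in> inner_nbrs a"
        have "z \<in> set q"
        proof (rule ccontr)
          assume zq: "z \<notin> set q"
          have "z \<in> V" "{z, a} \<in> E"
            using z edgeD[of a z] by (auto simp: inner_nbrs_def nbrs_def insert_commute)
          then have "z # q \<in> paths"
            using zq gq nlq z r by (auto simp: paths_def graph_path_def inner_nbrs_def)
          then show False using max[of "z # q"] lq by simp
        qed
        then show "z \<in> {b}"
          using path_hd_nbr_unique[of a b r z] gq r z by (auto simp: inner_nbrs_def)
      qed
    qed
    then show ?thesis using r by simp
  qed
  have ends: "inner_nbrs v \<subseteq> set p \<and> card (inner_nbrs v) = 1" if "v \<in> {hd p, last p}" for v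
    using end1[of p] end1[of "rev p"] that gp by (auto simp: hd_rev graph_path_def)
  have mid: "inner_nbrs v \<subseteq> set p \<and> card (inner_nbrs v) = 2" if v: "v \<in> set p - {hd p, last p}" for v
  proof -
    obtain a b where ab: "p = a @ v # b"
      using v by (meson DiffD1 split_list)
    have ne: "a \<noteq> []" "b \<noteq> []" using v ab by auto
    have sub: "{last a, hd b} \<subseteq> inner_nbrs v"
      using gp nl ne ab by (auto simp: inner_nbrs_def nbrs_def graph_path_def
          successively_append_hd_last successively_Cons insert_commute)
    have "last a \<in> set a" "hd b \<in> set b" using ne by auto
    then have "last a \<noteq> hd b"
      using gp ab by (auto simp: graph_path_def)
    then have c2: "card {last a, hd b} = 2" by simp
    \<comment> \<open>The two neighbours of \<open>v\<close> on the path are inner already, and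
      \<open>le2\<close> admits no third one.\<close>
    have "inner_nbrs v = {last a, hd b}"
      using card_subset_eq[OF finite_inner_nbrs sub] le2[of v] c2 pV v
        card_mono[OF finite_inner_nbrs sub] by auto
    then show ?thesis using c2 ab ne by auto
  qed
  have out: "deg E x = 1 \<and> (\<exists>v\<in>set p. {v, x} \<in> E)" if x: "x \<in> V - set p" for x
  proof -
    have pne: "p \<noteq> []" using len2 by auto
    \<comment> \<open>On a path from \<open>x\<close> to the spine, let \<open>v\<close> be the
      first spine vertex and \<open>z\<close> the vertex before it. As \<open>z\<close> is off the
      spine it is a leaf, so the path cannot pass through it, and \<open>z = x\<close>.\<close>
    obtain q where q: "graph_path_between V E x q (hd p)"
      using connected x pne pV by (metis DiffD1 hd_in_set subsetD)
    then have "\<exists>z\<in>set q. z \<in> set p"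
      using pne by (auto simp: graph_path_between_def graph_path_def) (metis hd_in_set last_in_set)
    then obtain a v b where qs: "q = a @ v # b" and v: "v \<in> set p" and a: "\<forall>z\<in>set a. z \<notin> set p"
      using split_list_first_prop[of q "\<lambda>z. z \<in> set p"] by blast
    have "a \<noteq> []" using q qs x v by (auto simp: graph_path_between_def)
    then obtain a' z where a': "a = a' @ [z]" by (meson rev_exhaust)
    have gq: "graph_path V E (a' @ z # v # b)"
      using q qs a' by (simp add: graph_path_between_def)
    have vz: "z \<in> nbrs E v" 
      using gq by (auto simp: graph_path_def nbrs_def successively_append_hd_last insert_commute)
    have "inner_nbrs v \<subseteq> set p"
      using ends[of v] mid[of v] v by blast
    then have dz: "deg E z = 1"
      using vz a a' by (auto simp: inner_nbrs_def)
    then have "a' = []"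
      using path_inner_not_leaf[OF gq] by auto
    then have "z = x" using q qs a' by (auto simp: graph_path_between_def)
    then show ?thesis using dz vz v by (auto simp: nbrs_def)
  qed
  show ?thesis
    unfolding caterpillar_def
  proof (intro conjI exI[of _ p] ballI)
    show "card (leaf_nbrs E v) + 1 = deg E v" if "v \<in> {hd p, last p}" for v
      using ends[OF that] deg_split[of v] by simp
    show "deg E v = 2 \<or> card (leaf_nbrs E v) + 2 = deg E v" if "v \<in> set p - {hd p, last p}" for v
      using mid[OF that] deg_split[of v] by simp
  qed (use tree gp out in blast)+
qed

end

section \<open>Curvature of trees\<close>

text \<open>The easy half of Kantorovich duality: for every coupling the sum of
  \<open>q x y * (f x - f y)\<close> depends on the marginals only. It bounds the cost from below by
  \<open>lip\<close> and equals the cost of \<open>q0\<close> by \<open>tight\<close>. The Lipschitz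
  bound is asked only between the two supports, because a coupling carries no mass
  elsewhere.\<close>

lemma transport_dist_dual:
  assumes fin: "finite V" and q0: "coupling V m n q0"
    and lip: "\<And>x y. x \<in> V \<Longrightarrow> y \<in> V \<Longrightarrow> m x \<noteq> 0 \<Longrightarrow> n y \<noteq> 0 \<Longrightarrow> f x - f y \<le> d x y"
    and tight: "\<And>x y. x \<in> V \<Longrightarrow> y \<in> V \<Longrightarrow> q0 x y \<noteq> 0 \<Longrightarrow> d x y = f x - f y"
  shows "transport_dist V d m n = (\<Sum>x\<in>V. f x * (m x - n x))"
proof -
  have dual: "(\<Sum>x\<in>V. \<Sum>y\<in>V. q x y * (f x - f y)) = (\<Sum>x\<in>V. f x * (m x - n x))"
    if q: "coupling V m n q" for q
  proof -
    have "(\<Sum>x\<in>V. \<Sum>y\<in>V. q x y * f x) = (\<Sum>x\<in>V. f x * m x)"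
      using q by (intro sum.cong refl)
        (simp add: coupling_def mult.commute flip: sum_distrib_left)
    moreover have "(\<Sum>x\<in>V. \<Sum>y\<in>V. q x y * f y) = (\<Sum>y\<in>V. f y * n y)"
      using q by (subst sum.swap, intro sum.cong refl)
        (simp add: coupling_def mult.commute flip: sum_distrib_left)
    ultimately show ?thesis
      by (simp add: right_diff_distrib sum_subtractf)
  qed
  have lower: "(\<Sum>x\<in>V. f x * (m x - n x)) \<le> (\<Sum>x\<in>V. \<Sum>y\<in>V. q x y * d x y)"
    if q: "coupling V m n q" for q
    unfolding dual[OF q, symmetric]
  proof (intro sum_mono)
    fix x y assume xy: "x \<in> V" "y \<in> V"
    have nonneg: "\<And>x y. x \<in> V \<Longrightarrow> y \<in> V \<Longrightarrow> q x y \<ge> 0"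
      and row: "(\<Sum>y\<in>V. q x y) = m x" and col: "(\<Sum>x\<in>V. q x y) = n y"
      using q xy by (auto simp: coupling_def)
    have "q x y = 0" if "m x = 0 \<or> n y = 0"
      using that row col nonneg xy fin
      by (auto simp: sum_nonneg_eq_0_iff)
    then show "q x y * (f x - f y) \<le> q x y * d x y"
      using lip[OF xy] nonneg[OF xy] by (cases "m x = 0 \<or> n y = 0") (auto intro: mult_left_mono)
  qed
  have "(\<Sum>x\<in>V. \<Sum>y\<in>V. q0 x y * d x y) = (\<Sum>x\<in>V. \<Sum>y\<in>V. q0 x y * (f x - f y))"
    by (intro sum.cong refl) (use tight in force)
  then have attained: "(\<Sum>x\<in>V. f x * (m x - n x)) = (\<Sum>x\<in>V. \<Sum>y\<in>V. q0 x y * d x y)"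
    using dual[OF q0] by simp
  show ?thesis
    unfolding transport_dist_def
    by (rule cInf_eq_minimum) (use q0 attained lower in auto)
qed

text \<open>
  The product coupling, with the mass sent from \<open>v\<close> to \<open>u\<close> cancelled against mass sent
  from \<open>u\<close> to \<open>v\<close>.
\<close>

lemma product_coupling_no_backflow:
  fixes m n :: "'a \<Rightarrow> real"
  assumes fin: "finite V" and uv: "u \<in> V" "v \<in> V" "u \<noteq> v"
    and nonneg: "\<And>x. x \<in> V \<Longrightarrow> m x \<ge> 0" "\<And>x. x \<in> V \<Longrightarrow> n x \<ge> 0"
    and total: "(\<Sum>x\<in>V. m x) = 1" "(\<Sum>x\<in>V. n x) = 1"
    and le: "m v * n u \<le> m u * n v"
  defines "s \<equiv> \<lambda>x. (if x = v then 1 else 0) - (if x = u then 1 else 0 :: real)"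
  shows "coupling V m n (\<lambda>x y. m x * n y + m v * n u * (s x * s y))"
proof -
  have s0: "(\<Sum>x\<in>V. s x) = 0"
    using fin uv by (simp add: s_def sum_subtractf sum.delta)
  \<comment> \<open>The pairs \<open>(u, u)\<close> and \<open>(v, v)\<close> gain mass and
    \<open>(v, u)\<close> drops to exactly zero. Only \<open>(u, v)\<close> loses mass that it might
    not have, and \<open>le\<close> covers this.\<close>
  have "m x * n y + m v * n u * (s x * s y) \<ge> 0" if "x \<in> V" "y \<in> V" for x y
    using nonneg[of x] nonneg[of y] nonneg[OF uv(1)] nonneg[OF uv(2)] that le uv
    by (auto simp: s_def split: if_splits)
  moreover have "(\<Sum>y\<in>V. m x * n y + m v * n u * (s x * s y)) = m x" for x
    using s0 total by (simp add: sum.distrib flip: sum_distrib_left)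
  moreover have "(\<Sum>x\<in>V. m x * n y + m v * n u * (s x * s y)) = n y" for y
    using s0 total
    by (simp add: sum.distrib flip: sum_distrib_left sum_distrib_right)
  ultimately show ?thesis
    by (auto simp: coupling_def)
qed

section \<open>Lazy measures and the curvature formula on a tree\<close>

context tree_graph
begin

lemma inv_weight_sum_pos:
  assumes "edge_metric E w" "z \<in> nbrs E u"
  shows "inv_weight_sum E w u > 0"
  unfolding inv_weight_sum_def
  using assms finite_nbrs by (intro sum_pos) (auto simp: edge_metric_def nbrs_def)

lemma inverse_inv_weight_sum_le:
  assumes "edge_metric E w" "z \<in> nbrs E u"
  shows "1 / inv_weight_sum E w u \<le> w {u, z}"
proof -
  have pos: "w {u, z} > 0" using assms by (auto simp: edge_metric_def nbrs_def)
  have "1 / w {u, z} \<le> inv_weight_sum E w u"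
    unfolding inv_weight_sum_def
    by (rule member_le_sum[where f = "\<lambda>z. 1 / w {u, z}"])
      (use assms finite_nbrs in \<open>auto simp: edge_metric_def nbrs_def intro: less_imp_le\<close>)
  then show ?thesis
    using pos inv_weight_sum_pos[OF assms] by (simp add: field_simps)
qed

lemma sum_lazy_measure:
  assumes u: "u \<in> V"
  shows "(\<Sum>x\<in>V. g x * lazy_measure E w \<alpha> u x) =
    g u * \<alpha> + (1 - \<alpha>) / inv_weight_sum E w u * (\<Sum>x\<in>nbrs E u. g x / w {u, x})"
proof -
  have "(\<Sum>x\<in>V. g x * lazy_measure E w \<alpha> u x) = (\<Sum>x\<in>insert u (nbrs E u). g x * lazy_measure E w \<alpha> u x)"
    using finite_V nbrs_subset u by (intro sum.mono_neutral_right) (auto simp: lazy_measure_def)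
  also have "\<dots> = g u * \<alpha> + (\<Sum>x\<in>nbrs E u. g x * lazy_measure E w \<alpha> u x)"
    using not_self_nbr finite_nbrs by (simp add: lazy_measure_def)
  also have "(\<Sum>x\<in>nbrs E u. g x * lazy_measure E w \<alpha> u x) =
      (\<Sum>x\<in>nbrs E u. (1 - \<alpha>) / inv_weight_sum E w u * (g x / w {u, x}))"
    using not_self_nbr by (intro sum.cong refl) (auto simp: lazy_measure_def mult_ac)
  finally show ?thesis by (simp add: sum_distrib_left)
qed

lemma lazy_measure_total:
  assumes "edge_metric E w" "z \<in> nbrs E u"
  shows "(\<Sum>x\<in>V. lazy_measure E w \<alpha> u x) = 1"
proof -
  have "u \<in> V" using assms edgeD[of u z] by (simp add: nbrs_def)
  then show ?thesis
    using sum_lazy_measure[where g = "\<lambda>_. 1"] inv_weight_sum_pos[OF assms]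
    by (simp flip: inv_weight_sum_def)
qed

lemma lazy_measure_nonneg:
  assumes "edge_metric E w" "0 \<le> \<alpha>" "\<alpha> \<le> 1"
  shows "lazy_measure E w \<alpha> u x \<ge> 0"
proof (cases "x \<in> nbrs E u")
  case True
  then show ?thesis
    using assms inv_weight_sum_pos[OF assms(1) True]
    by (auto simp: lazy_measure_def edge_metric_def nbrs_def intro!: mult_nonneg_nonneg divide_nonneg_nonneg
        intro: less_imp_le)
qed (use assms in \<open>auto simp: lazy_measure_def\<close>)

lemma lazy_measure_nbr_le:
  assumes "edge_metric E w" "\<alpha> \<le> 1" "x \<in> nbrs E u"
  shows "lazy_measure E w \<alpha> u x \<le> 1 - \<alpha>"
proof -
  have w: "w {u, x} > 0" and D: "inv_weight_sum E w u > 0"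
    using assms inv_weight_sum_pos by (auto simp: edge_metric_def nbrs_def)
  have "1 / w {u, x} / inv_weight_sum E w u \<le> 1"
    using inverse_inv_weight_sum_le[OF assms(1,3)] w D by (simp add: field_simps)
  then show ?thesis
    using assms not_self_nbr[of u] mult_left_mono[of "1 / w {u, x} / inv_weight_sum E w u" 1 "1 - \<alpha>"]
    by (auto simp: lazy_measure_def)
qed

text \<open>The potential \<open>f\<close> decreases from the far neighbours of \<open>u\<close>
  through \<open>u\<close> and \<open>v\<close> to the far neighbours of \<open>v\<close>. It
  realizes all distances between the two supports except for the pair \<open>(v, u)\<close>, which
  is traversed uphill. The coupling without backflow avoids this pair, so duality gives the
  distance.\<close>

lemma transport_dist_lazy:
  assumes w: "edge_metric E w" and uv: "{u, v} \<in> E" and \<alpha>: "1/2 \<le> \<alpha>" "\<alpha> \<le> 1"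
  shows "transport_dist V (path_dist V E w) (lazy_measure E w \<alpha> u) (lazy_measure E w \<alpha> v) =
    w {u, v} + (1 - \<alpha>) * ((real (deg E u) - 2) / inv_weight_sum E w u +
                             (real (deg E v) - 2) / inv_weight_sum E w v)"
proof -
  let ?m = "lazy_measure E w \<alpha> u" and ?n = "lazy_measure E w \<alpha> v"
  let ?W = "w {u, v}" and ?d = "path_dist V E w"
  define f where "f = (\<lambda>z. if z = u then ?W else if z = v then 0
     else if z \<in> nbrs E u then ?W + w {u, z} else - w {v, z})"
  define s where "s = (\<lambda>x. (if x = v then 1 else 0) - (if x = u then 1 else 0 :: real))"
  define q where "q = (\<lambda>x y. ?m x * ?n y + ?m v * ?n u * (s x * s y))"
  note uvD = edgeD[OF uv]
  have nb: "v \<in> nbrs E u" "u \<in> nbrs E v"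
    using uv by (auto simp: nbrs_def insert_commute)
  have W: "?W > 0" using w uv by (simp add: edge_metric_def)
  have disj: "x \<notin> nbrs E v" if "x \<in> nbrs E u" for x
    using that no_triangle[of x u v] uv by (auto simp: nbrs_def insert_commute)
  have fuv: "f u = ?W" "f v = 0" using uvD by (auto simp: f_def)
  have dist: "?d x y = f x - f y" if x: "x = u \<or> x = v \<or> x \<in> nbrs E u"
    and y: "y = u \<or> y = v \<or> y \<in> nbrs E v" and nvu: "\<not> (x = v \<and> y = u)" for x y
  proof -
    have fx: "f x = (if x = u then ?W else if x = v then 0 else ?W + w {u, x})"
      using x by (auto simp: f_def)
    have fy: "f y = (if y = u then ?W else if y = v then 0 else - w {v, y})"
      using y disj by (auto simp: f_def)
    consider "x = u" "y = u" | "x = u" "y = v" | "x = u" "y \<noteq> u" "y \<noteq> v" "y \<in> nbrs E v"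
      | "x = v" "y = v" | "x = v" "y \<noteq> u" "y \<noteq> v" "y \<in> nbrs E v"
      | "x \<noteq> u" "x \<noteq> v" "x \<in> nbrs E u" "y = u" | "x \<noteq> u" "x \<noteq> v" "x \<in> nbrs E u" "y = v"
      | "x \<noteq> u" "x \<noteq> v" "x \<in> nbrs E u" "y \<noteq> u" "y \<noteq> v" "y \<in> nbrs E v"
      using x y nvu by blast
    \<comment> \<open>In each case the path is a segment of \<open>x\<close>, \<open>u\<close>,
      \<open>v\<close>, \<open>y\<close>; the absence of triangles keeps its vertices
      distinct.\<close>
    then have "\<exists>p. graph_path_between V E x p y \<and> path_weight w p = f x - f y"
    proof cases
      case 1 then show ?thesis
        using uvD by (intro exI[of _ "[u]"]) (auto simp: graph_path_between_def graph_path_def path_weight_def)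
    next
      case 2 then show ?thesis
        using uvD uv by (intro exI[of _ "[u, v]"]) (auto simp: graph_path_between_def graph_path_def path_weight_def fx fy fuv)
    next
      case 3 
      have "y \<in> V" using 3 nbrs_subset by blast
      then show ?thesis
        using uvD uv 3 by (intro exI[of _ "[u, v, y]"]) (auto simp: graph_path_between_def graph_path_def path_weight_def fx fy fuv nbrs_def)
    next
      case 4 then show ?thesis
        using uvD by (intro exI[of _ "[v]"]) (auto simp: graph_path_between_def graph_path_def path_weight_def)
    next
      case 5
      have "y \<in> V" using 5 nbrs_subset by blast
      then show ?thesis
        using uvD 5 by (intro exI[of _ "[v, y]"]) (auto simp: graph_path_between_def graph_path_def path_weight_def fx fy fuv nbrs_def)
    next
      case 6
      have "x \<in> V" "{x, u} \<in> E" using 6 nbrs_subset by (auto simp: nbrs_def insert_commute)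
      then show ?thesis
        using uvD 6 by (intro exI[of _ "[x, u]"]) (auto simp: graph_path_between_def graph_path_def path_weight_def fx fy fuv insert_commute)
    next
      case 7
      have "x \<in> V" "{x, u} \<in> E" using 7 nbrs_subset by (auto simp: nbrs_def insert_commute)
      then show ?thesis
        using uvD uv 7 by (intro exI[of _ "[x, u, v]"]) (auto simp: graph_path_between_def graph_path_def path_weight_def fx fy fuv insert_commute)
    next
      case 8
      have "x \<in> V" "{x, u} \<in> E" "y \<in> V" "{v, y} \<in> E" using 8 nbrs_subset by (auto simp: nbrs_def insert_commute)
      moreover have "x \<noteq> y" using disj 8 by blast
      ultimately show ?thesis
        using uvD uv 8 by (intro exI[of _ "[x, u, v, y]"]) (auto simp: graph_path_between_def graph_path_def path_weight_def fx fy fuv insert_commute)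
    qed
    then show ?thesis using path_dist_path by metis
  qed
  have supp: "x = u \<or> x \<in> nbrs E u" if "?m x \<noteq> 0" for x
    using that by (auto simp: lazy_measure_def split: if_splits)
  have supp': "y = v \<or> y \<in> nbrs E v" if "?n y \<noteq> 0" for y
    using that by (auto simp: lazy_measure_def split: if_splits)
  have dvu: "?d v u = ?W"
  proof -
    have "graph_path_between V E v [v, u] u"
      using uv uvD by (auto simp: graph_path_between_def graph_path_def insert_commute)
    from path_dist_path[OF this] show ?thesis by (simp add: path_weight_def insert_commute)
  qed
  \<comment> \<open>Here \<open>1/2 \<le> \<alpha>\<close> enters: the left side is at most
    \<open>(1 - \<alpha>) * (1 - \<alpha>)\<close>, the right side is
    \<open>\<alpha> * \<alpha>\<close>.\<close>
  have le: "?m v * ?n u \<le> ?m u * ?n v"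
  proof -
    have "?m v * ?n u \<le> (1 - \<alpha>) * (1 - \<alpha>)"
      using lazy_measure_nbr_le[OF w \<alpha>(2)] lazy_measure_nonneg[OF w] nb \<alpha>
      by (intro mult_mono) auto
    also have "\<dots> \<le> \<alpha> * \<alpha>" using \<alpha> by (intro mult_mono) auto
    finally show ?thesis by (simp add: lazy_measure_def)
  qed
  have coup: "coupling V ?m ?n q"
    unfolding q_def s_def
    by (rule product_coupling_no_backflow)
      (use finite_V uvD lazy_measure_nonneg[OF w] lazy_measure_total[OF w] nb \<alpha> le in auto)
  have "transport_dist V ?d ?m ?n = (\<Sum>x\<in>V. f x * (?m x - ?n x))"
  proof (rule transport_dist_dual[OF finite_V coup])
    fix x y assume "?m x \<noteq> 0" "?n y \<noteq> 0"
    then have *: "x = u \<or> x = v \<or> x \<in> nbrs E u" "y = u \<or> y = v \<or> y \<in> nbrs E v"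
      using supp supp' by blast+
    show "f x - f y \<le> ?d x y"
    proof (cases "x = v \<and> y = u")
      case True
      then show ?thesis using dvu W uvD by (auto simp: f_def)
    qed (use dist[OF *] in simp)
  next
    fix x y assume q: "q x y \<noteq> 0"
    have "s z \<noteq> 0 \<Longrightarrow> z = u \<or> z = v" for z by (auto simp: s_def split: if_splits)
    moreover have "?m x \<noteq> 0 \<or> s x \<noteq> 0" "?n y \<noteq> 0 \<or> s y \<noteq> 0" using q by (auto simp: q_def)
    ultimately have *: "x = u \<or> x = v \<or> x \<in> nbrs E u" "y = u \<or> y = v \<or> y \<in> nbrs E v"
      using supp supp' by blast+
    \<comment> \<open>The correction cancels the product exactly, since
      \<open>s v * s u = - 1\<close>.\<close>
    have "q v u = 0" using uvD by (simp add: q_def s_def)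
    then show "?d x y = f x - f y"
      using q by (intro dist[OF *]) auto
  qed
  also have "\<dots> = (\<Sum>x\<in>V. f x * ?m x) - (\<Sum>x\<in>V. f x * ?n x)"
    by (simp add: right_diff_distrib sum_subtractf)
  also have "(\<Sum>x\<in>V. f x * ?m x) = ?W + (1 - \<alpha>) * ((real (deg E u) - 2) / inv_weight_sum E w u)"
  proof -
    \<comment> \<open>The formula for a far neighbour would give \<open>2\<close> at
      \<open>x = v\<close>, where \<open>f\<close> vanishes; hence the subtracted \<open>2\<close>,
      which becomes the \<open>- 2\<close> in \<open>deg E u - 2\<close>.\<close>
    have "(\<Sum>x\<in>nbrs E u. f x / w {u, x}) = (\<Sum>x\<in>nbrs E u. ?W * (1 / w {u, x}) + 1 - (if x = v then 2 else 0))"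
    proof (intro sum.cong refl)
      fix x assume "x \<in> nbrs E u"
      moreover from this have "w {u, x} > 0" "x \<noteq> u"
        using w not_self_nbr by (auto simp: edge_metric_def nbrs_def)
      ultimately show "f x / w {u, x} = ?W * (1 / w {u, x}) + 1 - (if x = v then 2 else 0)"
        using uvD by (auto simp: f_def field_simps)
    qed
    also have "\<dots> = ?W * inv_weight_sum E w u + real (deg E u) - 2"
      using nb finite_nbrs
      by (simp add: sum.distrib sum_subtractf deg_def inv_weight_sum_def sum_distrib_left)
    finally have eq: "(\<Sum>x\<in>nbrs E u. f x / w {u, x}) = ?W * inv_weight_sum E w u + real (deg E u) - 2" .
    show ?thesis
      using inv_weight_sum_pos[OF w nb(1)] unfolding sum_lazy_measure[OF uvD(1)] eq fuv
      by (simp add: field_simps)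
  qed
  also have "(\<Sum>x\<in>V. f x * ?n x) = - (1 - \<alpha>) * ((real (deg E v) - 2) / inv_weight_sum E w v)"
  proof -
    \<comment> \<open>Each far neighbour of \<open>v\<close> contributes \<open>- 1\<close>, while
      \<open>u\<close> contributes \<open>1 = 2 - 1\<close>.\<close>
    have "(\<Sum>x\<in>nbrs E v. f x / w {v, x}) = (\<Sum>x\<in>nbrs E v. (if x = u then 2 else 0) - 1)"
    proof (intro sum.cong refl)
      fix x assume x: "x \<in> nbrs E v"
      moreover from this have "w {v, x} > 0" "x \<noteq> v"
        using w not_self_nbr by (auto simp: edge_metric_def nbrs_def)
      moreover have "x \<notin> nbrs E u" using x disj by blast
      ultimately show "f x / w {v, x} = (if x = u then 2 else 0) - 1"
        using uvD by (auto simp: f_def insert_commute)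
    qed
    also have "\<dots> = 2 - real (deg E v)"
      using nb finite_nbrs by (simp add: sum_subtractf deg_def)
    finally have eq: "(\<Sum>x\<in>nbrs E v. f x / w {v, x}) = 2 - real (deg E v)" .
    show ?thesis
      using inv_weight_sum_pos[OF w nb(2)] unfolding sum_lazy_measure[OF uvD(2)] eq fuv
      by (simp add: field_simps)
  qed
  finally show ?thesis by (simp only: distrib_left mult_minus_left)
qed

text \<open>The right-hand side of the unnormalized flow, that is, minus curvature times weight;
  unlike the curvature it has no division by \<open>w e\<close>.\<close>

definition speed :: "('a set \<Rightarrow> real) \<Rightarrow> 'a set \<Rightarrow> real" where
  "speed w e = (\<Sum>u\<in>e. (real (deg E u) - 2) / inv_weight_sum E w u)"

lemma speed_doubleton:
  assumes "{u, v} \<in> E"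
  shows "speed w {u, v} = (real (deg E u) - 2) / inv_weight_sum E w u +
                          (real (deg E v) - 2) / inv_weight_sum E w v"
  using edgeD(3)[OF assms] by (simp add: speed_def)

text \<open>For \<open>\<alpha>\<close> between \<open>1/2\<close> and \<open>1\<close> the
  transportation distance is affine in \<open>1 - \<alpha>\<close>, so the quotient defining the
  curvature is constant there and the limit is immediate.\<close>

lemma edge_curvature_speed:
  assumes w: "edge_metric E w" and e: "e \<in> E"
  shows "edge_curvature V E w e * w e = - speed w e"
proof -
  obtain u v where uv: "e = {u, v}" "u \<noteq> v" "u \<in> V" "v \<in> V" using edge_cases[OF e] by metis
  have E: "{u, v} \<in> E" using e uv by simp
  have W: "w {u, v} > 0" using w E by (simp add: edge_metric_def)
  have "graph_path_between V E u [u, v] v"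
    using E uv by (auto simp: graph_path_between_def graph_path_def)
  then have d: "path_dist V E w u v = w {u, v}"
    using path_dist_path by (simp add: path_weight_def)
  have alg: "(1 - (W + (1 - \<alpha>) * S) / W) / (1 - \<alpha>) = - (S / W)" if "W > 0" "\<alpha> < 1" for W S \<alpha> :: real
  proof -
    have "1 - (W + (1 - \<alpha>) * S) / W = (1 - \<alpha>) * (- (S / W))" using that by (simp add: field_simps)
    then show ?thesis using that by simp
  qed
  have "lazy_curvature V E w \<alpha> u v / (1 - \<alpha>) = - (speed w e / w e)" if "\<alpha> \<in> {1/2<..<1}" for \<alpha>
    unfolding lazy_curvature_def
    using that alg[OF W] transport_dist_lazy[OF w E, of \<alpha>]
    by (simp add: d uv(1) speed_doubleton[OF E])
  then have "eventually (\<lambda>\<alpha>. lazy_curvature V E w \<alpha> u v / (1 - \<alpha>) = - (speed w e / w e)) (at_left 1)"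
    using eventually_at_left_real[of "1/2" "1::real"] by (auto elim: eventually_mono)
  then have "((\<lambda>\<alpha>. lazy_curvature V E w \<alpha> u v / (1 - \<alpha>)) \<longlongrightarrow> - (speed w e / w e)) (at_left 1)"
    by (rule tendsto_eventually)
  then have "lly_curvature V E w u v = - (speed w e / w e)"
    unfolding lly_curvature_def by (intro tendsto_Lim) auto
  then show ?thesis
    using W by (simp add: uv(1) edge_curvature_doubleton)
qed

end

section \<open>Behaviour of the flows\<close>

lemma growth_ge:
  fixes f :: "real \<Rightarrow> real"
  assumes "a \<le> b" "a \<ge> 0"
    and der: "\<And>x. x \<ge> 0 \<Longrightarrow> (f has_real_derivative f' x) (at x within {0..})"
    and ge: "\<And>x. a \<le> x \<Longrightarrow> x \<le> b \<Longrightarrow> m \<le> f' x"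
  shows "f a + m * (b - a) \<le> f b"
proof -
  have "(f has_derivative (*) (f' x)) (at x within {a..b})" if "a \<le> x" "x \<le> b" for x
    using der[of x] that assms(2)
    by (auto simp: has_field_derivative_def intro: has_derivative_subset)
  from mvt_very_simple[OF assms(1) this] obtain x where "x \<in> {a..b}" "f b - f a = f' x * (b - a)"
    by blast
  then show ?thesis
    using ge[of x] mult_right_mono[of m "f' x" "b - a"] assms(1) by auto
qed

lemma growth_le:
  fixes f :: "real \<Rightarrow> real"
  assumes "a \<le> b" "a \<ge> 0"
    and der: "\<And>x. x \<ge> 0 \<Longrightarrow> (f has_real_derivative f' x) (at x within {0..})"
    and le: "\<And>x. a \<le> x \<Longrightarrow> x \<le> b \<Longrightarrow> f' x \<le> m"
  shows "f b \<le> f a + m * (b - a)"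
  using growth_ge[OF assms(1,2) DERIV_minus[OF der], of "- m"] le by auto

lemma growth_strict:
  fixes f :: "real \<Rightarrow> real"
  assumes "a < b" "a \<ge> 0"
    and der: "\<And>x. x \<ge> 0 \<Longrightarrow> (f has_real_derivative f' x) (at x within {0..})"
    and pos: "\<And>x. x \<ge> 0 \<Longrightarrow> 0 < f' x"
  shows "f a < f b"
proof -
  have "(f has_derivative (*) (f' x)) (at x within {a..b})" if "a \<le> x" "x \<le> b" for x
    using der[of x] that assms(2)
    by (auto simp: has_field_derivative_def intro: has_derivative_subset)
  from mvt_simple[OF assms(1) this] obtain x where "x \<in> {a<..<b}" "f b - f a = f' x * (b - a)"
    by blast
  moreover from this have "f' x * (b - a) > 0"
    using pos[of x] assms(1,2) by (intro mult_pos_pos) auto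
  ultimately show ?thesis by linarith
qed

text \<open>Gronwall's argument: with \<open>K\<close> a bound for \<open>\<bar>r\<bar>\<close> on
  \<open>[0, T]\<close>, the function \<open>(g t)\<^sup>2 * exp (- 2 * K * t)\<close> is
  nonincreasing, nonnegative and zero at the start.\<close>

lemma linear_ode_zero:
  fixes g r :: "real \<Rightarrow> real"
  assumes der: "\<And>t. t \<ge> 0 \<Longrightarrow> (g has_real_derivative r t * g t) (at t within {0..})"
    and cont: "continuous_on {0..} r" and g0: "g 0 = 0" and T: "T \<ge> 0"
  shows "g T = 0"
proof -
  have "bounded (r ` {0..T})"
    by (intro compact_imp_bounded compact_continuous_image continuous_on_subset[OF cont]) auto
  then obtain K where "\<forall>x\<in>r ` {0..T}. norm x \<le> K"
    unfolding bounded_iff by blast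
  then have K: "\<bar>r t\<bar> \<le> K" if "0 \<le> t" "t \<le> T" for t
    using that by auto
  define G where "G = (\<lambda>t. (g t)\<^sup>2 * exp (- 2 * K * t))"
  have "G T \<le> G 0 + 0 * (T - 0)"
  proof (rule growth_le[OF T, where f' = "\<lambda>t. 2 * (r t - K) * G t"])
    fix t :: real assume t: "t \<ge> 0"
    show "(G has_real_derivative 2 * (r t - K) * G t) (at t within {0..})"
      unfolding G_def
      by (rule derivative_eq_intros der[OF t] refl | simp add: algebra_simps power2_eq_square)+
  next
    fix t assume "0 \<le> t" "t \<le> T"
    then have "r t - K \<le> 0" using K[of t] by auto
    then show "2 * (r t - K) * G t \<le> 0"
      by (intro mult_nonpos_nonneg[of "2 * (r t - K)"]) (auto simp: G_def)
  qed simp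
  then show ?thesis
    using g0 by (simp add: G_def mult_le_0_iff)
qed

text \<open>\<open>R\<close> is nonincreasing. If it stayed above some \<open>\<epsilon>\<close>,
  its slope would be bounded away from zero and it would reach zero in finite time.\<close>

lemma decay_to_zero:
  fixes R :: "real \<Rightarrow> real"
  assumes der: "\<And>t. t \<ge> 0 \<Longrightarrow> (R has_real_derivative R' t) (at t within {0..})"
    and pos: "\<And>t. t \<ge> 0 \<Longrightarrow> R t > 0" and L: "L > 0"
    and le: "\<And>t. t \<ge> 0 \<Longrightarrow> R' t \<le> - (R t)\<^sup>2 / (L + R t)"
  shows "(R \<longlongrightarrow> 0) at_top"
proof -
  have neg: "R' t \<le> 0" if "t \<ge> 0" for t
    using le[OF that] pos[OF that] L by (smt (verit) divide_nonneg_pos minus_divide_left zero_le_power2)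
  have mono: "R t \<le> R s" if "0 \<le> s" "s \<le> t" for s t
    using growth_le[OF that(2,1) der, where m = 0] neg that by force
  show ?thesis
  proof (rule decreasing_tendsto)
    show "eventually (\<lambda>t. 0 \<le> R t) at_top"
      using pos by (intro eventually_at_top_linorderI[of 0]) (auto intro: less_imp_le)
    fix \<epsilon> :: real assume \<epsilon>: "\<epsilon> > 0"
    have "\<exists>t\<ge>0. R t < \<epsilon>"
    proof (rule ccontr)
      assume "\<not> (\<exists>t\<ge>0. R t < \<epsilon>)"
      then have ge: "R t \<ge> \<epsilon>" if "t \<ge> 0" for t using that by force
      \<comment> \<open>Over all times the numerator is at least \<open>\<epsilon>\<^sup>2\<close>
        and, by monotonicity, the denominator at most \<open>L + R 0\<close>. At time
        \<open>R 0 / c\<close> a decay at rate \<open>c\<close> has used up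
        \<open>R 0\<close>.\<close>
      define c where "c = \<epsilon>\<^sup>2 / (L + R 0)"
      have c: "c > 0" using \<epsilon> L pos[of 0] by (simp add: c_def)
      have R'c: "R' t \<le> - c" if t: "t \<ge> 0" for t
      proof -
        have "c \<le> (R t)\<^sup>2 / (L + R t)"
          unfolding c_def
          using ge[OF t] mono[of 0 t] t L \<epsilon> by (intro frac_le power_mono) auto
        then show ?thesis using le[OF t] by simp
      qed
      define t where "t = R 0 / c"
      have t: "t \<ge> 0" using c pos[of 0] by (simp add: t_def)
      have "R t \<le> R 0 + (- c) * (t - 0)"
        by (rule growth_le[OF t _ der]) (use R'c in auto)
      also have "\<dots> = 0" using c by (simp add: t_def)
      finally show False using pos[OF t] by simp
    qed
    then obtain t where "t \<ge> 0" "R t < \<epsilon>" by blast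
    then show "eventually (\<lambda>t. R t < \<epsilon>) at_top"
      using mono by (intro eventually_at_top_linorderI[of t]) (metis le_less_trans)
  qed
qed

text \<open>The AM-HM inequality, from Cauchy-Schwarz for \<open>sqrt (f x)\<close> and
  \<open>1 / sqrt (f x)\<close>.\<close>

lemma sum_inverse_ge:
  fixes f :: "'b \<Rightarrow> real"
  assumes fin: "finite A" "A \<noteq> {}" and pos: "\<And>x. x \<in> A \<Longrightarrow> f x > 0"
  shows "(real (card A))\<^sup>2 / (\<Sum>x\<in>A. f x) \<le> (\<Sum>x\<in>A. 1 / f x)"
proof -
  have S: "(\<Sum>x\<in>A. f x) > 0" using assms by (intro sum_pos) auto
  have "(\<Sum>x\<in>A. 1 * 1)\<^sup>2 = (\<Sum>x\<in>A. sqrt (f x) * (1 / sqrt (f x)))\<^sup>2"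
    using pos by (intro arg_cong[of _ _ power2] sum.cong refl) (auto simp: less_imp_neq[symmetric])
  also have "\<dots> \<le> (\<Sum>x\<in>A. (sqrt (f x))\<^sup>2) * (\<Sum>x\<in>A. (1 / sqrt (f x))\<^sup>2)"
    by (rule Cauchy_Schwarz_ineq_sum)
  also have "\<dots> = (\<Sum>x\<in>A. f x) * (\<Sum>x\<in>A. 1 / f x)"
    using pos by (intro arg_cong2[of _ _ _ _ "(*)"] sum.cong refl)
      (auto simp: power_divide less_imp_le)
  finally show ?thesis using S by (simp add: field_simps)
qed

section \<open>Speeds of edges and a common form of both flows\<close>

context tree_graph
begin

lemma edge_other_end:
  assumes "e \<in> E" "u \<in> e"
  obtains z where "e = {u, z}" "z \<in> nbrs E u"
proof -
  obtain x y where "e = {x, y}" using edge_cases[OF assms(1)] by metis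
  then have "\<exists>z. e = {u, z}" using assms(2) by (auto simp: doubleton_eq_iff)
  then show thesis using assms(1) that by (auto simp: nbrs_def)
qed

text \<open>At the leaf the degree is \<open>1\<close> and the inverse weight sum is the single term
  \<open>1 / w {c, z}\<close>, so this end contributes \<open>- w {c, z}\<close>.\<close>

lemma speed_leaf_edge:
  assumes z: "z \<in> leaf_nbrs E c"
  shows "speed w {c, z} = (real (deg E c) - 2) / inv_weight_sum E w c - w {c, z}"
proof -
  have e: "{c, z} \<in> E" and d: "deg E z = 1" and cz: "c \<in> nbrs E z"
    using z by (auto simp: leaf_nbrs_def nbrs_def insert_commute)
  then show ?thesis
    using speed_doubleton[OF e] deg_le_one[OF d cz]
    by (simp add: inv_weight_sum_def insert_commute)
qed

text \<open>The end \<open>z\<close> has degree at least two, so its contribution is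
  nonnegative.\<close>

lemma speed_inner_edge_ge:
  assumes w: "edge_metric E w" and z: "z \<in> inner_nbrs c"
  shows "(real (deg E c) - 2) / inv_weight_sum E w c \<le> speed w {c, z}"
proof -
  have e: "{c, z} \<in> E" and cz: "c \<in> nbrs E z" and d: "deg E z \<noteq> 1"
    using z by (auto simp: inner_nbrs_def nbrs_def insert_commute)
  have "(real (deg E z) - 2) / inv_weight_sum E w z \<ge> 0"
    using deg_ge_two[OF cz d] inv_weight_sum_pos[OF w cz] by (intro divide_nonneg_pos) auto
  then show ?thesis using speed_doubleton[OF e] by simp
qed

text \<open>
  Multiplying out \<open>\<Prod> w\<close> over the edges at \<open>c\<close> cancels \<open>D\<^sub>c\<close>: the logarithmic derivative is
  bounded below by a constant.
\<close>

lemma sum_log_speed_ge: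
  assumes w: "edge_metric E w" and ne: "nbrs E c \<noteq> {}"
  shows "real (card (inner_nbrs c)) - 2 \<le> (\<Sum>z\<in>nbrs E c. speed w {c, z} / w {c, z})"
proof -
  define D where "D = inv_weight_sum E w c"
  have D: "D > 0" using inv_weight_sum_pos[OF w] ne by (auto simp: D_def)
  have pos: "w {c, z} > 0" if "z \<in> nbrs E c" for z
    using w that by (auto simp: edge_metric_def nbrs_def)
  have "real (card (inner_nbrs c)) - 2 = (real (deg E c) - 2) / D * D - real (card (leaf_nbrs E c))"
    using D deg_split[of c] by simp
  also have "\<dots> = (\<Sum>z\<in>nbrs E c. (real (deg E c) - 2) / D / w {c, z} - (if z \<in> leaf_nbrs E c then 1 else 0))"
    using finite_nbrs
    by (simp add: sum_subtractf D_def inv_weight_sum_def sum_distrib_left sum.If_cases leaf_nbrs_def Int_def conj_commute)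
  also have "\<dots> \<le> (\<Sum>z\<in>nbrs E c. speed w {c, z} / w {c, z})"
  proof (rule sum_mono)
    fix z assume z: "z \<in> nbrs E c"
    show "(real (deg E c) - 2) / D / w {c, z} - (if z \<in> leaf_nbrs E c then 1 else 0) \<le> speed w {c, z} / w {c, z}"
    proof (cases "z \<in> leaf_nbrs E c")
      case True
      then show ?thesis
        using pos[OF z] speed_leaf_edge[OF True, of w] by (simp add: D_def diff_divide_distrib)
    next
      case False
      then have "z \<in> inner_nbrs c" using z nbrs_split(1)[of c] by blast
      then show ?thesis
        using divide_right_mono[OF speed_inner_edge_ge[OF w], of z c "w {c, z}"] pos[OF z] False
        by (simp add: D_def)
    qed
  qed
  finally show ?thesis .
qed

text \<open>The common form allows one argument at a branching vertex for both flows: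
  \<open>r = 0\<close> is the unnormalized flow, and minus the sum of all speeds is the rate of the
  normalized one.\<close>

definition flow_with_rate :: "(real \<Rightarrow> real) \<Rightarrow> (real \<Rightarrow> 'a set \<Rightarrow> real) \<Rightarrow> bool" where
  "flow_with_rate r w \<longleftrightarrow>
     (\<forall>t\<ge>0. edge_metric E (w t)) \<and>
     (\<forall>t\<ge>0. \<forall>e\<in>E. ((\<lambda>s. w s e) has_real_derivative speed (w t) e + r t * w t e) (at t within {0..}))"

lemma flow_with_rateD:
  assumes "flow_with_rate r w" "t \<ge> 0"
  shows "edge_metric E (w t)"
    and "e \<in> E \<Longrightarrow> w t e > 0"
    and "e \<in> E \<Longrightarrow> ((\<lambda>s. w s e) has_real_derivative speed (w t) e + r t * w t e) (at t within {0..})"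
  using assms by (auto simp: flow_with_rate_def edge_metric_def)

lemma unnormalized_flow_with_rate:
  "unnormalized_ricci_flow V E w0 w \<longleftrightarrow> (\<forall>e\<in>E. w 0 e = w0 e) \<and> flow_with_rate (\<lambda>t. 0) w"
proof -
  have "- edge_curvature V E (w t) e * w t e = speed (w t) e"
    if "\<forall>t\<ge>0. \<forall>e\<in>E. w t e > 0" "t \<ge> 0" "e \<in> E" for t e
    using edge_curvature_speed[of "w t" e] that by (simp add: edge_metric_def)
  then show ?thesis
    unfolding unnormalized_ricci_flow_def flow_with_rate_def edge_metric_def by force
qed

lemma normalized_flow_with_rate:
  assumes "normalized_ricci_flow V E w0 w"
  shows "flow_with_rate (\<lambda>t. - (\<Sum>h\<in>E. speed (w t) h)) w"
proof -
  have met: "edge_metric E (w t)" if "t \<ge> 0" for t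
    using assms that by (auto simp: normalized_ricci_flow_def edge_metric_def)
  have "- edge_curvature V E (w t) e * w t e + w t e * (\<Sum>h\<in>E. edge_curvature V E (w t) h * w t h)
      = speed (w t) e + - (\<Sum>h\<in>E. speed (w t) h) * w t e" if "t \<ge> 0" "e \<in> E" for t e
    using edge_curvature_speed[OF met[OF that(1)]] that
    by (simp add: sum_negf mult.commute)
  then show ?thesis
    using assms met unfolding normalized_ricci_flow_def flow_with_rate_def
    by (metis (no_types, lifting))
qed

section \<open>Vertices with at least three inner neighbours\<close>

text \<open>The logarithm of the product of the weights at \<open>c\<close> eventually grows at
  least linearly, whereas eventual bounds on the weights would bound it from above.\<close>

lemma branching_flow_unbounded:
  assumes flow: "flow_with_rate r w" and r: "(r \<longlongrightarrow> 0) at_top"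
    and c: "card (inner_nbrs c) \<ge> 3"
    and bdd: "\<And>z. z \<in> nbrs E c \<Longrightarrow> \<exists>B. eventually (\<lambda>t. w t {c, z} \<le> B) at_top"
  shows False
proof -
  define f where "f = (\<lambda>t. \<Sum>z\<in>nbrs E c. ln (w t {c, z}))"
  define f' where "f' = (\<lambda>t. \<Sum>z\<in>nbrs E c. speed (w t) {c, z} / w t {c, z} + r t)"
  have ne: "nbrs E c \<noteq> {}" using c by (auto simp: inner_nbrs_def)
  have der: "(f has_real_derivative f' t) (at t within {0..})" if t: "t \<ge> 0" for t
    unfolding f_def f'_def
  proof (rule DERIV_sum)
    fix z assume "z \<in> nbrs E c"
    then have e: "{c, z} \<in> E" by (simp add: nbrs_def)
    show "((\<lambda>t. ln (w t {c, z})) has_real_derivative speed (w t) {c, z} / w t {c, z} + r t) (at t within {0..})"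
      using flow_with_rateD(2)[OF flow t e]
      by (auto intro!: derivative_eq_intros flow_with_rateD(3)[OF flow t e] simp: field_simps)
  qed
  have "((\<lambda>t. real (deg E c) * r t) \<longlongrightarrow> real (deg E c) * 0) at_top"
    by (intro tendsto_intros r)
  \<comment> \<open>With three inner neighbours the constant part of the slope is at least
    \<open>1\<close>; losing at most \<open>1/2\<close> to the rate term leaves slope
    \<open>1/2\<close>.\<close>
  then have "eventually (\<lambda>t. real (deg E c) * r t > - 1/2) at_top"
    by (rule order_tendstoD) simp
  then obtain t0 where t0: "t0 \<ge> 0" "\<And>t. t \<ge> t0 \<Longrightarrow> real (deg E c) * r t > - 1/2"
    unfolding eventually_at_top_linorder by (metis linorder_linear order_trans)
  have f'_ge: "f' t \<ge> 1/2" if "t \<ge> t0" for t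
  proof -
    have "f' t \<ge> real (card (inner_nbrs c)) - 2 + real (deg E c) * r t"
      using sum_log_speed_ge[OF _ ne] flow_with_rateD(1)[OF flow] t0(1) that
      by (simp add: f'_def sum.distrib deg_def)
    then show ?thesis using t0(2)[OF that] c by linarith
  qed
  have f_ge: "f t0 + 1/2 * (t - t0) \<le> f t" if "t \<ge> t0" for t
    by (rule growth_ge[OF that t0(1) der]) (use f'_ge in auto)
  obtain B where B: "\<And>z. z \<in> nbrs E c \<Longrightarrow> eventually (\<lambda>t. w t {c, z} \<le> B z) at_top"
    using bdd by metis
  have "eventually (\<lambda>t. \<forall>z\<in>nbrs E c. w t {c, z} \<le> B z) at_top"
    using B by (intro eventually_ball_finite finite_nbrs) auto
  \<comment> \<open>At slope \<open>1/2\<close> this time suffices for \<open>f\<close> to exceed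
    the bound given by \<open>B\<close>.\<close>
  moreover have "eventually (\<lambda>t. t \<ge> max t0 (t0 + 2 * ((\<Sum>z\<in>nbrs E c. ln (B z)) - f t0) + 1)) at_top"
    by (rule eventually_ge_at_top)
  ultimately obtain t where t: "\<forall>z\<in>nbrs E c. w t {c, z} \<le> B z"
      "t \<ge> max t0 (t0 + 2 * ((\<Sum>z\<in>nbrs E c. ln (B z)) - f t0) + 1)"
    using eventually_happens'[OF trivial_limit_at_top_linorder eventually_conj] by blast
  have "f t \<le> (\<Sum>z\<in>nbrs E c. ln (B z))"
    unfolding f_def
  proof (rule sum_mono)
    fix z assume z: "z \<in> nbrs E c"
    have "w t {c, z} > 0"
      using flow_with_rateD(2)[OF flow, of t] t(2) z t0(1) by (auto simp: nbrs_def)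
    then show "ln (w t {c, z}) \<le> ln (B z)" using t(1) z by (auto intro: ln_mono)
  qed
  moreover have "t \<ge> t0" "t \<ge> t0 + 2 * ((\<Sum>z\<in>nbrs E c. ln (B z)) - f t0) + 1" using t(2) by auto
  ultimately show False using f_ge[of t] by argo
qed

text \<open>Inner edges at \<open>c\<close> increase strictly, so one that is unbounded tends to
  infinity. If all were bounded, so would be the leaf edges at \<open>c\<close>, because a leaf edge
  minus an inner edge is nonincreasing; this contradicts
  \<open>branching_flow_unbounded\<close>.\<close>

lemma non_caterpillar_edge_to_infinity:
  assumes flow: "flow_with_rate (\<lambda>t. 0) w" and c: "card (inner_nbrs c) \<ge> 3"
  shows "\<exists>e\<in>E. strict_mono_on {0..} (\<lambda>t. w t e) \<and> filterlim (\<lambda>t. w t e) at_top at_top"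
proof -
  have d: "deg E c \<ge> 3" using c deg_split[of c] by linarith
  have ne: "nbrs E c \<noteq> {}" using c by (auto simp: inner_nbrs_def)
  have inner: "{c, z} \<in> E" if "z \<in> inner_nbrs c" for z
    using that by (simp add: inner_nbrs_def nbrs_def)
  have speed: "speed (w t) {c, z} > 0" if "z \<in> inner_nbrs c" "t \<ge> 0" for z t
  proof -
    have "0 < (real (deg E c) - 2) / inv_weight_sum E (w t) c"
      using d inv_weight_sum_pos[OF flow_with_rateD(1)[OF flow that(2)]] ne
      by (auto intro!: divide_pos_pos)
    then show ?thesis
      using speed_inner_edge_ge[OF flow_with_rateD(1)[OF flow that(2)] that(1)] by simp
  qed
  have der: "((\<lambda>t. w t e) has_real_derivative speed (w t) e) (at t within {0..})" if "e \<in> E" "t \<ge> 0" for e t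
    using flow_with_rateD(3)[OF flow that(2,1)] by simp
  have mono: "strict_mono_on {0..} (\<lambda>t. w t {c, z})" if z: "z \<in> inner_nbrs c" for z
    using growth_strict[OF _ _ der[OF inner[OF z]] speed[OF z]]
    by (auto intro!: strict_mono_onI)
  show ?thesis
  proof (rule ccontr)
    assume no: "\<not> ?thesis"
    have bdd_inner: "\<exists>B. \<forall>t\<ge>0. w t {c, z} \<le> B" if z: "z \<in> inner_nbrs c" for z
    proof (rule ccontr)
      assume "\<not> ?thesis"
      then have unb: "\<And>B. \<exists>t\<ge>0. w t {c, z} > B" by (meson not_le)
      have "filterlim (\<lambda>t. w t {c, z}) at_top at_top"
        unfolding filterlim_at_top
      proof
        fix B
        obtain s where s: "s \<ge> 0" "w s {c, z} > B" using unb by blast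
        show "eventually (\<lambda>t. B \<le> w t {c, z}) at_top"
        proof (rule eventually_at_top_linorderI)
          fix t assume "s \<le> t"
          then show "B \<le> w t {c, z}"
            using s strict_mono_onD[OF mono[OF z], of s t] by (cases "s = t") auto
        qed
      qed
      then show False using no mono[OF z] inner[OF z] by blast
    qed
    have "inner_nbrs c \<noteq> {}" using c by auto
    then obtain a where a: "a \<in> inner_nbrs c" by blast
    obtain A where A: "\<And>t. t \<ge> 0 \<Longrightarrow> w t {c, a} \<le> A" using bdd_inner[OF a] by blast
    have "\<exists>B. eventually (\<lambda>t. w t {c, z} \<le> B) at_top" if z: "z \<in> nbrs E c" for z
    proof (cases "z \<in> inner_nbrs c")
      case True
      then show ?thesis using bdd_inner eventually_at_top_linorder by blast
    next
      case False
      then have l: "z \<in> leaf_nbrs E c" using z nbrs_split(1)[of c] by blast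
      have zE: "{c, z} \<in> E" using z by (simp add: nbrs_def)
      have "w t {c, z} \<le> A + (w 0 {c, z} - w 0 {c, a})" if t: "t \<ge> 0" for t
      proof -
        have "w t {c, z} - w t {c, a} \<le> w 0 {c, z} - w 0 {c, a} + 0 * (t - 0)"
        proof (rule growth_le[OF t order_refl DERIV_diff[OF der[OF zE] der[OF inner[OF a]]]])
          fix s :: real assume s: "0 \<le> s"
          have "speed (w s) {c, z} < speed (w s) {c, a}"
            using speed_leaf_edge[OF l, of "w s"] flow_with_rateD(2)[OF flow s zE]
              speed_inner_edge_ge[OF flow_with_rateD(1)[OF flow s] a] by linarith
          then show "speed (w s) {c, z} - speed (w s) {c, a} \<le> 0" by simp
        qed
        then show ?thesis using A[OF t] by simp
      qed
      then show ?thesis using eventually_at_top_linorder by blast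
    qed
    then show False
      using branching_flow_unbounded[OF flow _ c] by auto
  qed
qed

text \<open>Each speed tends to minus the product of limit weight and limit curvature. This product
  vanishes on every edge: either the limit weight is zero or the curvature is.\<close>

lemma zero_curvature_limit_rate:
  assumes flow: "flow_with_rate r w"
    and conv: "converges_to_constant_curvature E w 0"
  shows "((\<lambda>t. \<Sum>h\<in>E. speed (w t) h) \<longlongrightarrow> 0) at_top"
proof -
  obtain winf where winf: "\<forall>e\<in>E. winf e \<ge> 0"
      "\<forall>e\<in>E. ((\<lambda>t. w t e) \<longlongrightarrow> winf e) at_top"
      "\<forall>e\<in>E. winf e > 0 \<longrightarrow> limit_curvature E winf e = 0"
    using conv unfolding converges_to_constant_curvature_def by (elim exE conjE)
  note nonneg = winf(1)[rule_format] and lim = winf(2)[rule_format] and curv = winf(3)[rule_format]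
  \<comment> \<open>This is where the convention that \<open>D_u\<close> is infinite comes from: one
    vanishing edge at \<open>u\<close> forces \<open>1 / D_u\<close> to zero, since
    \<open>1 / D_u\<close> is at most its weight.\<close>
  have zero: "((\<lambda>t. 1 / inv_weight_sum E (w t) u) \<longlongrightarrow> 0) at_top"
    if h: "h \<in> E" "u \<in> h" "winf h = 0" for u h
  proof -
    obtain z where z: "h = {u, z}" and uz: "z \<in> nbrs E u"
      using edge_other_end[OF h(1,2)] by blast
    show ?thesis
    proof (rule tendsto_sandwich[OF _ _ tendsto_const])
      show "eventually (\<lambda>t. 0 \<le> 1 / inv_weight_sum E (w t) u) at_top"
        using inv_weight_sum_pos[OF flow_with_rateD(1)[OF flow] uz]
        by (intro eventually_at_top_linorderI[of 0]) (auto intro: less_imp_le)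
      show "eventually (\<lambda>t. 1 / inv_weight_sum E (w t) u \<le> w t h) at_top"
        using inverse_inv_weight_sum_le[OF flow_with_rateD(1)[OF flow] uz]
        by (intro eventually_at_top_linorderI[of 0]) (auto simp: z)
      show "((\<lambda>t. w t h) \<longlongrightarrow> 0) at_top" using lim[OF h(1)] h(3) by simp
    qed
  qed
  have term_lim: "((\<lambda>t. (real (deg E u) - 2) / inv_weight_sum E (w t) u) \<longlongrightarrow>
      - (winf e * limit_curvature_term E winf e u)) at_top"
    if e: "e \<in> E" "u \<in> e" for u e
  \<comment> \<open>If \<open>winf e = 0\<close>, then \<open>e\<close> itself is a witness for the
    first case, so the second case has only positive limit weights at \<open>u\<close>, and the
    inverse weight sums converge.\<close>
  proof (cases "\<exists>h\<in>E. u \<in> h \<and> winf h = 0")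
    case True
    then obtain h where "h \<in> E" "u \<in> h" "winf h = 0" by blast
    from zero[OF this]
    have "((\<lambda>t. (real (deg E u) - 2) * (1 / inv_weight_sum E (w t) u)) \<longlongrightarrow> (real (deg E u) - 2) * 0) at_top"
      by (rule tendsto_mult_left)
    then show ?thesis using True by (simp add: limit_curvature_term_def)
  next
    case False
    then have pos: "winf h > 0" if "h \<in> E" "u \<in> h" for h
      using nonneg[OF that(1)] that by force
    obtain z where uz: "z \<in> nbrs E u"
      using edge_other_end[OF e] by blast
    have "inv_weight_sum E winf u > 0"
      unfolding inv_weight_sum_def
      using uz finite_nbrs by (intro sum_pos) (auto simp: nbrs_def intro!: pos)
    moreover have "((\<lambda>t. inv_weight_sum E (w t) u) \<longlongrightarrow> inv_weight_sum E winf u) at_top"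
      unfolding inv_weight_sum_def
    proof (intro tendsto_sum tendsto_divide tendsto_const)
      fix y assume "y \<in> nbrs E u"
      then have "{u, y} \<in> E" by (simp add: nbrs_def)
      then show "((\<lambda>t. w t {u, y}) \<longlongrightarrow> winf {u, y}) at_top" "winf {u, y} \<noteq> 0"
        using lim[of "{u, y}"] pos[of "{u, y}"] by simp_all
    qed
    ultimately have "((\<lambda>t. (real (deg E u) - 2) / inv_weight_sum E (w t) u) \<longlongrightarrow>
        (real (deg E u) - 2) / inv_weight_sum E winf u) at_top"
      by (intro tendsto_intros) auto
    moreover have "(real (deg E u) - 2) / inv_weight_sum E winf u = - (winf e * limit_curvature_term E winf e u)"
    proof -
      have "limit_curvature_term E winf e u = (2 - real (deg E u)) / (winf e * inv_weight_sum E winf u)"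
        using False by (simp only: limit_curvature_term_def if_False)
      moreover have "(real (deg E u) - 2) / D = - ((2 - real (deg E u)) / D)" for D
        by (metis minus_diff_eq minus_divide_left)
      ultimately show ?thesis using pos[OF e] by simp
    qed
    ultimately show ?thesis by simp
  qed
  have "((\<lambda>t. speed (w t) e) \<longlongrightarrow> 0) at_top" if e: "e \<in> E" for e
  proof -
    have "((\<lambda>t. speed (w t) e) \<longlongrightarrow> (\<Sum>u\<in>e. - (winf e * limit_curvature_term E winf e u))) at_top"
      unfolding speed_def by (intro tendsto_sum term_lim[OF e])
    also have "(\<Sum>u\<in>e. - (winf e * limit_curvature_term E winf e u)) = - (winf e * limit_curvature E winf e)"
      by (simp add: limit_curvature_def sum_negf sum_distrib_left)
    also have "\<dots> = 0" using curv[OF e] nonneg[OF e] by (cases "winf e = 0") auto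
    finally show ?thesis .
  qed
  then show ?thesis by (intro tendsto_null_sum)
qed

text \<open>Convergent weights are eventually bounded and the rate tends to zero, so no vertex can
  have three inner neighbours.\<close>

lemma zero_curvature_caterpillar:
  assumes not_star: "\<not> is_star V E" and flow: "normalized_ricci_flow V E w0 w"
    and conv: "converges_to_constant_curvature E w 0"
  shows "caterpillar V E"
proof (rule caterpillarI[OF not_star], rule ccontr)
  fix c assume "\<not> card (inner_nbrs c) \<le> 2"
  then have c: "card (inner_nbrs c) \<ge> 3" by simp
  note rate = normalized_flow_with_rate[OF flow]
  have "((\<lambda>t. - (\<Sum>h\<in>E. speed (w t) h)) \<longlongrightarrow> 0) at_top"
    using tendsto_minus[OF zero_curvature_limit_rate[OF rate conv]] by simp
  moreover have "\<exists>B. eventually (\<lambda>t. w t {c, z} \<le> B) at_top" if z: "z \<in> nbrs E c" for z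
  proof -
    obtain l where "((\<lambda>t. w t {c, z}) \<longlongrightarrow> l) at_top"
      using conv z unfolding converges_to_constant_curvature_def nbrs_def by blast
    then have "eventually (\<lambda>t. w t {c, z} < l + 1) at_top"
      by (rule order_tendstoD) simp
    then show ?thesis
      by (intro exI[of _ "l + 1"]) (erule eventually_mono, simp)
  qed
  ultimately show False
    using branching_flow_unbounded[OF rate _ c] by blast
qed

section \<open>Total weight of the normalized flow and leaf edges of caterpillars\<close>

lemma continuous_speed:
  assumes flow: "flow_with_rate r w" and e: "e \<in> E"
  shows "continuous_on {0..} (\<lambda>t. speed (w t) e)"
proof -
  have cont: "continuous_on {0..} (\<lambda>t. w t h)" if "h \<in> E" for h
    using flow_with_rateD(3)[OF flow _ that]
    by (auto intro!: DERIV_continuous simp: continuous_on_eq_continuous_within)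
  have "continuous_on {0..} (\<lambda>t. (real (deg E u) - 2) / inv_weight_sum E (w t) u)" if u: "u \<in> e" for u
  proof -
    obtain z where z: "z \<in> nbrs E u"
      using edge_other_end[OF e u] by blast
    have "continuous_on {0..} (\<lambda>t. inv_weight_sum E (w t) u)"
      unfolding inv_weight_sum_def
    proof (intro continuous_on_sum continuous_on_divide continuous_on_const ballI)
      fix y assume "y \<in> nbrs E u"
      then have "{u, y} \<in> E" by (simp add: nbrs_def)
      then show "continuous_on {0..} (\<lambda>t. w t {u, y})" "\<And>t. t \<in> {0..} \<Longrightarrow> w t {u, y} \<noteq> 0"
        using cont flow_with_rateD(2)[OF flow] by force+
    qed
    moreover have "inv_weight_sum E (w t) u \<noteq> 0" if "t \<in> {0..}" for t
      using inv_weight_sum_pos[OF flow_with_rateD(1)[OF flow] z, of t] that by auto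
    ultimately show ?thesis by (intro continuous_intros) auto
  qed
  then show ?thesis unfolding speed_def by (intro continuous_on_sum)
qed

text \<open>Summing the flow equations, the total weight minus \<open>1\<close> solves the linear
  equation \<open>g' = r g\<close> with initial value zero.\<close>

lemma normalized_total_weight:
  assumes flow: "normalized_ricci_flow V E w0 w" and metric: "edge_metric E w0"
    and ne: "E \<noteq> {}" and t: "t \<ge> 0"
  shows "(\<Sum>e\<in>E. w t e) = 1"
proof -
  define r where "r = (\<lambda>t. - (\<Sum>h\<in>E. speed (w t) h))"
  have rate: "flow_with_rate r w"
    unfolding r_def by (rule normalized_flow_with_rate[OF flow])
  define g where "g = (\<lambda>t. (\<Sum>e\<in>E. w t e) - 1)"
  have "g t = 0"
  proof (rule linear_ode_zero[OF _ _ _ t])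
    fix s :: real assume s: "s \<ge> 0"
    have "(g has_real_derivative (\<Sum>e\<in>E. speed (w s) e + r s * w s e) - 0) (at s within {0..})"
      unfolding g_def
      by (intro derivative_intros DERIV_sum flow_with_rateD(3)[OF rate s])
    also have "(\<Sum>e\<in>E. speed (w s) e + r s * w s e) - 0 = (\<Sum>e\<in>E. speed (w s) e) + r s * (\<Sum>e\<in>E. w s e)"
      by (simp add: sum.distrib sum_distrib_left)
    also have "\<dots> = r s * g s"
      by (simp add: g_def r_def algebra_simps)
    finally show "(g has_real_derivative r s * g s) (at s within {0..})" .
  next
    show "continuous_on {0..} r"
      unfolding r_def by (intro continuous_intros continuous_speed[OF rate])
    have "(\<Sum>h\<in>E. w0 h) > 0"
      using metric ne finite_E by (intro sum_pos) (auto simp: edge_metric_def)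
    moreover have "(\<Sum>e\<in>E. w 0 e) = (\<Sum>e\<in>E. w0 e / (\<Sum>h\<in>E. w0 h))"
      using flow by (intro sum.cong refl) (auto simp: normalized_ricci_flow_def)
    ultimately show "g 0 = 0"
      by (simp add: g_def flip: sum_divide_distrib)
  qed
  then show ?thesis by (simp add: g_def)
qed

text \<open>
  The ratio \<open>R\<close> of the total leaf weight at \<open>v\<close> to the weight of an inner edge at \<open>v\<close> does not
  see the normalization, and \<open>1 / D\<^sub>v \<le> X a / (l\<^sup>2 a + X)\<close> by the AM-HM inequality.
\<close>

lemma leaf_speed_ratio_le:
  assumes w: "edge_metric E w" and l: "leaf_nbrs E v \<noteq> {}" and a: "a \<in> inner_nbrs v"
    and le2: "card (inner_nbrs v) \<le> 2"
  defines "X \<equiv> (\<Sum>z\<in>leaf_nbrs E v. w {v, z})" and "W \<equiv> w {v, a}"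
    and "L \<equiv> (real (card (leaf_nbrs E v)))\<^sup>2"
  shows "((\<Sum>z\<in>leaf_nbrs E v. speed w {v, z}) * W - X * speed w {v, a}) / W\<^sup>2
    \<le> - (X / W)\<^sup>2 / (L + X / W)"
proof -
  let ?l = "real (card (leaf_nbrs E v))" and ?D = "inv_weight_sum E w v"
  have nb: "a \<in> nbrs E v" using a by (simp add: inner_nbrs_def)
  have pos: "w {v, z} > 0" if "z \<in> nbrs E v" for z
    using w that by (auto simp: edge_metric_def nbrs_def)
  have lpos: "w {v, z} > 0" if "z \<in> leaf_nbrs E v" for z
    using pos that by (simp add: leaf_nbrs_def)
  have W: "W > 0" using pos nb by (simp add: W_def)
  have X: "X > 0" unfolding X_def using l lpos finite_leaf_nbrs by (intro sum_pos) auto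
  have l1: "?l \<ge> 1" using l finite_leaf_nbrs by (simp add: Suc_le_eq card_gt_0_iff)
  have L: "L > 0" using l1 by (simp add: L_def)
  have D: "?D > 0" using inv_weight_sum_pos[OF w nb] .
  have card_inner: "card (inner_nbrs v) \<ge> 1"
    using a finite_inner_nbrs by (metis Suc_le_eq One_nat_def card_gt_0_iff empty_iff)
  have "?D = (\<Sum>z\<in>leaf_nbrs E v. 1 / w {v, z}) + (\<Sum>z\<in>inner_nbrs v. 1 / w {v, z})"
    unfolding inv_weight_sum_def
    by (subst nbrs_split(1), rule sum.union_disjoint[OF finite_leaf_nbrs finite_inner_nbrs nbrs_split(2)])
  moreover have "L / X \<le> (\<Sum>z\<in>leaf_nbrs E v. 1 / w {v, z})"
    unfolding L_def X_def by (rule sum_inverse_ge) (use l lpos finite_leaf_nbrs in auto)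
  moreover have "1 / W \<le> (\<Sum>z\<in>inner_nbrs v. 1 / w {v, z})"
    unfolding W_def
    by (rule member_le_sum[OF a, where f = "\<lambda>z. 1 / w {v, z}"])
      (use finite_inner_nbrs pos in \<open>auto simp: inner_nbrs_def intro: less_imp_le\<close>)
  ultimately have "L / X + 1 / W \<le> ?D" by simp
  then have "1 / ?D \<le> 1 / (L / X + 1 / W)"
    using X W L by (intro divide_left_mono) (auto intro!: add_pos_pos mult_pos_pos D)
  also have "\<dots> = X * W / (L * W + X)" using X W L by (simp add: field_simps)
  finally have D_le: "1 / ?D \<le> X * W / (L * W + X)" .
  \<comment> \<open>Here the caterpillar property enters: with at most two inner neighbours,
    \<open>d_v - 2\<close> is at most the number of leaves.\<close>
  have dl: "real (deg E v) - 2 \<le> ?l"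
    using deg_split[of v] le2 l1 by auto
  have d2: "0 \<le> real (deg E v) - 2"
    using deg_split[of v] card_inner l1 by auto
  have "(\<Sum>z\<in>leaf_nbrs E v. speed w {v, z}) = ?l * ((real (deg E v) - 2) / ?D) - X"
    by (simp add: speed_leaf_edge sum_subtractf X_def)
  also have "\<dots> \<le> L * (1 / ?D) - X"
  proof -
    have "(real (deg E v) - 2) / ?D \<le> ?l / ?D" using dl D by (intro divide_right_mono) auto
    then have "?l * ((real (deg E v) - 2) / ?D) \<le> ?l * (?l / ?D)" by (intro mult_left_mono) auto
    then show ?thesis by (simp add: L_def power2_eq_square)
  qed
  also have "\<dots> \<le> L * (X * W / (L * W + X)) - X"
    using D_le L by (intro diff_right_mono mult_left_mono) auto
  also have "\<dots> = - X\<^sup>2 / (L * W + X)"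
  proof -
    have "L * W + X \<noteq> 0" using X W L by (metis add_pos_pos less_irrefl mult_pos_pos)
    then show ?thesis by (simp add: field_simps power2_eq_square)
  qed
  finally have sum_le: "(\<Sum>z\<in>leaf_nbrs E v. speed w {v, z}) \<le> - X\<^sup>2 / (L * W + X)" .
  have "speed w {v, a} \<ge> 0"
    using speed_inner_edge_ge[OF w a] d2 D by (meson divide_nonneg_pos order_trans)
  then have "(\<Sum>z\<in>leaf_nbrs E v. speed w {v, z}) * W - X * speed w {v, a} \<le> - X\<^sup>2 / (L * W + X) * W"
    using sum_le W X by (smt (verit) mult_nonneg_nonneg mult_right_mono)
  then have "((\<Sum>z\<in>leaf_nbrs E v. speed w {v, z}) * W - X * speed w {v, a}) / W\<^sup>2
      \<le> (- X\<^sup>2 / (L * W + X) * W) / W\<^sup>2"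
    by (intro divide_right_mono) auto
  also have "\<dots> = - (X / W)\<^sup>2 / (L + X / W)"
  proof -
    have "L + X / W = (L * W + X) / W" using W by (simp add: field_simps)
    moreover have "L * W + X \<noteq> 0" using X W L by (metis add_pos_pos less_irrefl mult_pos_pos)
    moreover have "(- X\<^sup>2 / Y * W) / W\<^sup>2 = - (X / W)\<^sup>2 / (Y / W)" if "Y \<noteq> 0" for Y
      using that W by (simp add: field_simps power2_eq_square)
    ultimately show ?thesis by simp
  qed
  finally show ?thesis .
qed

text \<open>The ratio \<open>R\<close> of leaf weight to inner weight at the neighbour
  \<open>v\<close> of the leaf tends to zero by \<open>decay_to_zero\<close>. Normalized weights are
  at most \<open>1\<close>, so the weight of \<open>e\<close> is at most \<open>R\<close>.\<close>

lemma caterpillar_leaf_to_zero: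
  assumes not_star: "\<not> is_star V E" and cat: "caterpillar V E" and metric: "edge_metric E w0"
    and flow: "normalized_ricci_flow V E w0 w" and e: "leaf_edge E e"
  shows "((\<lambda>t. w t e) \<longlongrightarrow> 0) at_top"
proof -
  have eE: "e \<in> E" using e by (simp add: leaf_edge_def)
  obtain x where xe: "x \<in> e" and dx: "deg E x = 1" using e by (auto simp: leaf_edge_def)
  obtain v where "e = {x, v}" using edge_other_end[OF eE xe] by blast
  then have xv: "e = {v, x}" "deg E x = 1" using dx by auto
  have x: "x \<in> leaf_nbrs E v" using xv eE by (simp add: leaf_nbrs_def nbrs_def)
  have v: "v \<in> V" using edgeD(1)[of v x] eE xv by simp
  obtain a where a: "a \<in> inner_nbrs v"
    using star_if_no_inner_nbrs[OF v] not_star by blast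
  have aE: "{v, a} \<in> E" using a by (simp add: inner_nbrs_def nbrs_def)
  define r where "r = (\<lambda>t. - (\<Sum>h\<in>E. speed (w t) h))"
  have rate: "flow_with_rate r w" unfolding r_def by (rule normalized_flow_with_rate[OF flow])
  define X where "X = (\<lambda>t. \<Sum>z\<in>leaf_nbrs E v. w t {v, z})"
  define R where "R = (\<lambda>t. X t / w t {v, a})"
  have lE: "{v, z} \<in> E" if "z \<in> leaf_nbrs E v" for z using that by (simp add: leaf_nbrs_def nbrs_def)
  note pos = flow_with_rateD(2)[OF rate]
  have X: "X t > 0" if "t \<ge> 0" for t
    unfolding X_def using x finite_leaf_nbrs that by (intro sum_pos) (auto intro!: pos lE)
  have "(R \<longlongrightarrow> 0) at_top"
  proof (rule decay_to_zero)
    fix t :: real assume t: "t \<ge> 0"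
    have "(X has_real_derivative (\<Sum>z\<in>leaf_nbrs E v. speed (w t) {v, z} + r t * w t {v, z})) (at t within {0..})"
      unfolding X_def by (intro DERIV_sum flow_with_rateD(3)[OF rate t] lE)
    then have "(R has_real_derivative
        ((\<Sum>z\<in>leaf_nbrs E v. speed (w t) {v, z} + r t * w t {v, z}) * w t {v, a}
          - X t * (speed (w t) {v, a} + r t * w t {v, a})) / (w t {v, a} * w t {v, a})) (at t within {0..})"
      unfolding R_def using pos[OF t aE]
      by (intro DERIV_divide flow_with_rateD(3)[OF rate t aE]) auto
    \<comment> \<open>The rate \<open>r\<close> scales numerator and denominator alike and
      cancels.\<close>
    also have "(\<Sum>z\<in>leaf_nbrs E v. speed (w t) {v, z} + r t * w t {v, z}) * w t {v, a}
          - X t * (speed (w t) {v, a} + r t * w t {v, a}) =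
        (\<Sum>z\<in>leaf_nbrs E v. speed (w t) {v, z}) * w t {v, a} - X t * speed (w t) {v, a}"
    proof -
      have "(\<Sum>z\<in>leaf_nbrs E v. speed (w t) {v, z} + r t * w t {v, z}) =
          (\<Sum>z\<in>leaf_nbrs E v. speed (w t) {v, z}) + r t * X t"
        by (simp add: sum.distrib X_def sum_distrib_left)
      then show ?thesis by (simp only: algebra_simps)
    qed
    finally show "(R has_real_derivative ((\<Sum>z\<in>leaf_nbrs E v. speed (w t) {v, z}) * w t {v, a} - X t * speed (w t) {v, a}) / (w t {v, a})\<^sup>2) (at t within {0..})"
      by (simp add: power2_eq_square)
    show "((\<Sum>z\<in>leaf_nbrs E v. speed (w t) {v, z}) * w t {v, a} - X t * speed (w t) {v, a}) / (w t {v, a})\<^sup>2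
        \<le> - (R t)\<^sup>2 / ((real (card (leaf_nbrs E v)))\<^sup>2 + R t)"
      unfolding R_def X_def
      by (rule leaf_speed_ratio_le)
        (use flow_with_rateD(1)[OF rate t] x a caterpillar_inner_nbrs[OF cat v] in auto)
    show "R t > 0" using X[OF t] pos[OF t aE] by (simp add: R_def)
  next
    show "(real (card (leaf_nbrs E v)))\<^sup>2 > 0"
      using x finite_leaf_nbrs by (auto simp: card_gt_0_iff)
  qed
  have le_R: "w t e \<le> R t" if t: "t \<ge> 0" for t
  proof -
    have le: "w t e \<le> X t"
      unfolding X_def xv(1)
      by (rule member_le_sum[OF x, where f = "\<lambda>z. w t {v, z}"])
        (use finite_leaf_nbrs pos[OF t] lE in \<open>auto intro: less_imp_le\<close>)
    have "w t {v, a} \<le> (\<Sum>e\<in>E. w t e)"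
      by (rule member_le_sum[OF aE]) (use finite_E pos[OF t] in \<open>auto intro: less_imp_le\<close>)
    moreover have "E \<noteq> {}" using eE by blast
    ultimately have "w t {v, a} \<le> 1"
      using normalized_total_weight[OF flow metric _ t] by simp
    then have "X t \<le> R t"
      using X[OF t] pos[OF t aE] by (simp add: R_def field_simps)
    then show ?thesis using le by simp
  qed
  show ?thesis
  proof (rule tendsto_sandwich[OF _ _ tendsto_const \<open>(R \<longlongrightarrow> 0) at_top\<close>])
    show "eventually (\<lambda>t. 0 \<le> w t e) at_top"
      using pos[OF _ eE] by (intro eventually_at_top_linorderI[of 0]) (simp add: less_imp_le)
    show "eventually (\<lambda>t. w t e \<le> R t) at_top"
      using le_R by (rule eventually_at_top_linorderI)
  qed
qed

end

section \<open>Explicit flows on two caterpillars\<close>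

lemma finite_tree_singleton: "finite_tree {x} {}"
proof -
  have "graph_path_between {x} {} x [x] x"
    by (simp add: graph_path_between_def graph_path_def)
  then show ?thesis by (auto simp: finite_tree_def)
qed

text \<open>A cycle through \<open>x\<close> would need two neighbours of \<open>x\<close>, but
  \<open>u\<close> is the only one; a cycle avoiding \<open>x\<close> lies in the old tree.\<close>

lemma finite_tree_add_leaf:
  assumes tree: "finite_tree V E" and u: "u \<in> V" and x: "x \<notin> V"
  shows "finite_tree (insert x V) (insert {u, x} E)"
proof -
  interpret tree_graph V E by unfold_locales (rule tree)
  let ?V = "insert x V" and ?E = "insert {u, x} E"
  have "u \<noteq> x" using u x by auto
  have xE: "{y, x} \<notin> E" "{x, y} \<notin> E" for y
    using edgeD[of x y] edgeD[of y x] x by auto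
  have old: "graph_path_between ?V ?E y p z" if "graph_path_between V E y p z" for y p z
    using that by (auto simp: graph_path_between_def graph_path_def elim: successively_mono)
  have to_x: "\<exists>p. graph_path_between ?V ?E y p x" if y: "y \<in> V" for y
  proof -
    obtain p where p: "graph_path_between V E y p u" using connected y u by blast
    then have "graph_path_between ?V ?E y (p @ [x]) x"
      using old[OF p] x
      by (auto simp: graph_path_between_def graph_path_def successively_append_hd_last insert_commute)
    then show ?thesis by blast
  qed
  have conn: "\<exists>p. graph_path_between ?V ?E y p z" if "y \<in> ?V" "z \<in> ?V" for y z
  proof -
    have "graph_path_between ?V ?E x [x] x"
      by (simp add: graph_path_between_def graph_path_def)
    moreover have "\<exists>p. graph_path_between ?V ?E x p z" if "z \<in> V"
      using to_x[OF that] graph_path_between_rev[of ?V ?E z _ x] by metis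
    ultimately show ?thesis
      using that to_x connected old by (metis insertE)
  qed
  have nbrs_x: "nbrs ?E x = {u}"
    using xE by (auto simp: nbrs_def doubleton_eq_iff)
  have cyc: "\<not> (graph_path ?V ?E p \<and> length p \<ge> 3 \<and> {last p, hd p} \<in> ?E)" for p
  proof
    assume p: "graph_path ?V ?E p \<and> length p \<ge> 3 \<and> {last p, hd p} \<in> ?E"
    have xp: "x \<notin> set p"
    proof
      assume "x \<in> set p"
      then show False using cycle_nbrs[of ?V ?E p x] p nbrs_x by force
    qed
    moreover have "last p \<in> set p" "hd p \<in> set p" using p by (auto simp: graph_path_def)
    ultimately have "last p \<noteq> x" "hd p \<noteq> x" by metis+
    then have "{last p, hd p} \<in> E"
      using p by (auto simp: doubleton_eq_iff)
    moreover have "successively (\<lambda>x y. {x, y} \<in> E) p"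
    proof (rule successively_mono)
      show "successively (\<lambda>x y. {x, y} \<in> ?E) p" using p by (simp add: graph_path_def)
      fix y z assume "y \<in> set p" "z \<in> set p" "{y, z} \<in> ?E"
      then show "{y, z} \<in> E" using xp by (auto simp: doubleton_eq_iff)
    qed
    ultimately show False
      using p xp acyclic[of p] by (auto simp: graph_path_def)
  qed
  show ?thesis
    unfolding finite_tree_def
  proof (intro conjI)
    show "\<forall>e\<in>?E. e \<subseteq> ?V \<and> card e = 2"
      using tree u \<open>u \<noteq> x\<close> by (auto simp: finite_tree_def)
    show "\<forall>y\<in>?V. \<forall>z\<in>?V. \<exists>p. graph_path_between ?V ?E y p z"
      using conn by blast
    show "\<not> (\<exists>p. graph_path ?V ?E p \<and> length p \<ge> 3 \<and> {last p, hd p} \<in> ?E)"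
      using cyc by blast
  qed (use finite_V in auto)
qed

section \<open>The path with four vertices: limits zero and finite positive\<close>

text \<open>Vertices and edges are listed so that each insertion attaches a leaf to the tree formed
  by the later entries, starting from vertex \<open>0\<close>; the same holds for the
  spider.\<close>

definition path4_V :: "nat set" where "path4_V = {3, 2, 1, 0}"
definition path4_E :: "nat set set" where "path4_E = {{2, 3}, {1, 2}, {0, 1}}"

lemma path4_tree: "finite_tree path4_V path4_E"
  unfolding path4_V_def path4_E_def
  by (intro finite_tree_add_leaf finite_tree_singleton) auto

lemma path4_nbrs:
  "nbrs path4_E 0 = {1}" "nbrs path4_E (Suc 0) = {0, 2}" "nbrs path4_E 2 = {1, 3}" "nbrs path4_E 3 = {2}"
  by (auto simp: nbrs_def path4_E_def doubleton_eq_iff)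

lemma path4_deg:
  "deg path4_E 0 = 1" "deg path4_E (Suc 0) = 2" "deg path4_E 2 = 2" "deg path4_E 3 = 1"
  by (simp_all add: deg_def path4_nbrs)

lemma path4_caterpillar: "caterpillar path4_V path4_E"
proof -
  have leaf: "leaf_nbrs path4_E (Suc 0) = {0}" "leaf_nbrs path4_E 2 = {3}"
    by (auto simp: leaf_nbrs_def path4_nbrs path4_deg)
  have adj: "{Suc 0, 0} \<in> path4_E" "{2, 3} \<in> path4_E"
    by (auto simp: path4_E_def)
  have "graph_path path4_V path4_E [1, 2]"
    by (simp add: graph_path_def path4_V_def path4_E_def)
  then show ?thesis
    unfolding caterpillar_def
    by (intro conjI path4_tree exI[of _ "[1, 2]"])
      (auto simp: path4_V_def path4_deg leaf adj)
qed

lemma path4_not_star: "\<not> is_star path4_V path4_E"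
  by (simp add: is_star_def path4_V_def path4_E_def doubleton_eq_iff insert_Diff_if)

text \<open>Both ends of the middle edge have degree two, so its speed is zero and it keeps its
  initial weight \<open>l\<close>. A leaf edge satisfies \<open>w' = - w\<close>.\<close>

lemma path4_flow:
  assumes l: "l > 0"
  defines "w \<equiv> \<lambda>t e. if e = {1, 2} then l else exp (- t)"
  shows "edge_metric path4_E (w 0)" "unnormalized_ricci_flow path4_V path4_E (w 0) w"
proof -
  interpret tree_graph path4_V path4_E by unfold_locales (rule path4_tree)
  have metric: "edge_metric path4_E (w t)" for t
    using l by (auto simp: edge_metric_def w_def)
  then show "edge_metric path4_E (w 0)" .
  have "((\<lambda>s. w s e) has_real_derivative speed (w t) e + 0 * w t e) (at t within {0..})"
    if e: "e \<in> path4_E" for t e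
  proof -
    consider "e = {2, 3}" | "e = {1, 2}" | "e = {0, 1}" using e by (auto simp: path4_E_def)
    then show ?thesis
    proof cases
      case 1
      have "speed (w t) e = - exp (- t)"
        using 1 e by (simp add: speed_doubleton path4_deg inv_weight_sum_def path4_nbrs w_def doubleton_eq_iff)
      then show ?thesis using 1
        by (auto simp: w_def doubleton_eq_iff intro!: derivative_eq_intros)
    next
      case 2
      have "speed (w t) e = 0"
        using 2 e by (simp add: speed_doubleton path4_deg)
      then show ?thesis using 2 by (simp add: w_def)
    next
      case 3
      have "speed (w t) e = - exp (- t)"
        using 3 e by (simp add: speed_doubleton path4_deg inv_weight_sum_def path4_nbrs w_def doubleton_eq_iff)
      then show ?thesis using 3
        by (auto simp: w_def doubleton_eq_iff intro!: derivative_eq_intros)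
    qed
  qed
  then show "unnormalized_ricci_flow path4_V path4_E (w 0) w"
    unfolding unnormalized_flow_with_rate flow_with_rate_def using metric by blast
qed

section \<open>A spider: limit infinity\<close>

text \<open>The centre \<open>0\<close> carries the legs 0-1-4 and 0-2-5 and the leaf
  \<open>3\<close>.\<close>

definition spider_V :: "nat set" where "spider_V = {5, 4, 3, 2, 1, 0}"
definition spider_E :: "nat set set" where "spider_E = {{2, 5}, {1, 4}, {0, 3}, {0, 2}, {0, 1}}"

lemma spider_tree: "finite_tree spider_V spider_E"
  unfolding spider_V_def spider_E_def
  by (intro finite_tree_add_leaf finite_tree_singleton) auto

lemma spider_nbrs:
  "nbrs spider_E 0 = {1, 2, 3}" "nbrs spider_E (Suc 0) = {0, 4}" "nbrs spider_E 2 = {0, 5}"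
  "nbrs spider_E 3 = {0}" "nbrs spider_E 4 = {1}" "nbrs spider_E 5 = {2}"
  by (auto simp: nbrs_def spider_E_def doubleton_eq_iff)

lemma spider_deg:
  "deg spider_E 0 = 3" "deg spider_E (Suc 0) = 2" "deg spider_E 2 = 2"
  "deg spider_E 3 = 1" "deg spider_E 4 = 1" "deg spider_E 5 = 1"
  by (simp_all add: deg_def spider_nbrs)

lemma spider_caterpillar: "caterpillar spider_V spider_E"
proof -
  have leaf: "leaf_nbrs spider_E 0 = {3}" "leaf_nbrs spider_E (Suc 0) = {4}" "leaf_nbrs spider_E 2 = {5}"
    by (auto simp: leaf_nbrs_def spider_nbrs spider_deg)
  have adj: "{0, 3} \<in> spider_E" "{Suc 0, 4} \<in> spider_E" "{2, 5} \<in> spider_E"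
    by (auto simp: spider_E_def)
  have "graph_path spider_V spider_E [1, 0, 2]"
    by (simp add: graph_path_def spider_V_def spider_E_def doubleton_eq_iff)
  then show ?thesis
    unfolding caterpillar_def
    by (intro conjI spider_tree exI[of _ "[1, 0, 2]"])
      (auto simp: spider_V_def spider_deg leaf adj)
qed

lemma spider_not_star: "\<not> is_star spider_V spider_E"
  by (simp add: is_star_def spider_V_def spider_E_def doubleton_eq_iff insert_Diff_if)

text \<open>
  With weights \<open>a\<close>, \<open>a\<close>, \<open>x\<close> at the centre of the spider, \<open>x a\<^sup>2\<close> is conserved. For \<open>x a\<^sup>2 = 1\<close>
  and \<open>a = exp s\<close> the flow becomes \<open>(exp (3 s) + 2) s' = 1\<close>, solved by \<open>exp (3 s) / 3 + 2 s = t\<close>.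
\<close>

lemma implicit_log_weight:
  obtains s :: "real \<Rightarrow> real" where
    "\<And>t. (s has_real_derivative 1 / (exp (3 * s t) + 2)) (at t)"
    "filterlim s at_top at_top"
proof -
  define H where "H = (\<lambda>s. exp (3 * s) / 3 + 2 * s :: real)"
  have strict: "H a < H b" if "a < b" for a b
    using that by (auto simp: H_def intro!: add_strict_mono)
  have cont: "isCont H y" for y
    unfolding H_def by (intro continuous_intros) auto
  \<comment> \<open>Bracketing points for the intermediate value theorem: at
    \<open>- (\<bar>t\<bar> + 1)\<close> the exponential is at most \<open>1\<close>, and at
    \<open>\<bar>t\<bar>\<close> the linear term alone is at least \<open>t\<close>.\<close>
  have surj: "\<exists>y. H y = t" for t
  proof -
    have "H (- (\<bar>t\<bar> + 1)) \<le> t"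
    proof -
      have "exp (3 * (- (\<bar>t\<bar> + 1))) \<le> (1::real)" by (subst exp_le_one_iff) auto
      then show ?thesis unfolding H_def by argo
    qed
    moreover have "t \<le> H \<bar>t\<bar>"
      using exp_gt_zero[of "3 * \<bar>t\<bar>"] unfolding H_def by argo
    moreover have "- (\<bar>t\<bar> + 1) \<le> \<bar>t\<bar>" by linarith
    ultimately show ?thesis
      using IVT[of H "- (\<bar>t\<bar> + 1)" t "\<bar>t\<bar>"] cont by blast
  qed
  then obtain s where Hs: "\<And>t. H (s t) = t" by metis
  have sH: "s (H y) = y" for y
    using strict[of "s (H y)" y] strict[of y "s (H y)"] Hs[of "H y"] by linarith
  have "(s has_real_derivative 1 / (exp (3 * s t) + 2)) (at t)" for t
  proof -
    have "isCont s (H (s t))"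
      by (rule isCont_inverse_function[where d = 1]) (auto simp: sH cont)
    then have "isCont s t" by (simp add: Hs)
    moreover have "(H has_real_derivative exp (3 * s t) + 2) (at (s t))"
      unfolding H_def by (auto intro!: derivative_eq_intros)
    moreover have "exp (3 * s t) + 2 \<noteq> 0" using exp_gt_zero[of "3 * s t"] by linarith
    ultimately have "(s has_real_derivative inverse (exp (3 * s t) + 2)) (at t)"
      using DERIV_inverse_function[of H "exp (3 * s t) + 2" s t "t - 1" "t + 1"] Hs by simp
    then show ?thesis by (simp add: inverse_eq_divide)
  qed
  moreover have "filterlim s at_top at_top"
    unfolding filterlim_at_top
  proof
    fix B
    show "eventually (\<lambda>t. B \<le> s t) at_top"
    proof (rule eventually_at_top_linorderI)
      fix t assume "H B \<le> t"
      then show "B \<le> s t" using strict[of "s t" B] Hs[of t] by linarith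
    qed
  qed
  ultimately show thesis using that by blast
qed

lemma spider_flow:
  obtains w where "edge_metric spider_E (w 0)" "unnormalized_ricci_flow spider_V spider_E (w 0) w"
    "filterlim (\<lambda>t. w t {0, 1}) at_top at_top"
proof -
  interpret tree_graph spider_V spider_E by unfold_locales (rule spider_tree)
  obtain s :: "real \<Rightarrow> real" where
    s': "\<And>t. (s has_real_derivative 1 / (exp (3 * s t) + 2)) (at t)"
    and lim: "filterlim s at_top at_top"
    using implicit_log_weight by blast
  \<comment> \<open>The weights at the centre are \<open>a\<close>, \<open>a\<close> and
    \<open>1 / a\<^sup>2\<close> with \<open>a = exp s\<close>. Vertices \<open>1\<close> and
    \<open>2\<close> have degree two and contribute nothing, so the outer edges decouple and decay
    as \<open>exp (- t)\<close>.\<close>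
  define w :: "real \<Rightarrow> nat set \<Rightarrow> real" where
    "w = (\<lambda>t e. if e = {0, 1} \<or> e = {0, 2} then exp (s t) else if e = {0, 3} then exp (- 2 * s t) else exp (- t))"
  have metric: "edge_metric spider_E (w t)" for t
    by (simp add: edge_metric_def w_def)
  have s'': "(s has_real_derivative 1 / (exp (3 * s t) + 2)) (at t within A)" for t A
    using s' by (rule has_field_derivative_at_within)
  have pos: "exp (3 * x) + 2 \<noteq> 0" for x :: real using exp_gt_zero[of "3 * x"] by linarith
  have D0: "1 / inv_weight_sum spider_E (w t) 0 = exp (s t) / (exp (3 * s t) + 2)" for t
  proof -
    have "inv_weight_sum spider_E (w t) 0 = 2 / exp (s t) + 1 / exp (- 2 * s t)"
      by (simp add: inv_weight_sum_def spider_nbrs w_def doubleton_eq_iff)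
    also have "\<dots> = (exp (3 * s t) + 2) / exp (s t)"
      by (simp add: field_simps exp_minus flip: exp_add)
    finally show ?thesis by simp
  qed
  have "((\<lambda>s. w s e) has_real_derivative speed (w t) e + 0 * w t e) (at t within {0..})"
    if e: "e \<in> spider_E" for t e
  proof -
    consider "e = {2, 5}" | "e = {1, 4}" | "e = {0, 3}" | "e = {0, 2}" | "e = {0, 1}"
      using e by (auto simp: spider_E_def)
    then show ?thesis
    proof cases
      case 1
      have "speed (w t) e = - exp (- t)"
        using 1 e by (simp add: speed_doubleton spider_deg inv_weight_sum_def spider_nbrs w_def doubleton_eq_iff)
      then show ?thesis using 1
        by (auto simp: w_def doubleton_eq_iff intro!: derivative_eq_intros)
    next
      case 2
      have "speed (w t) e = - exp (- t)"
        using 2 e by (simp add: speed_doubleton spider_deg inv_weight_sum_def spider_nbrs w_def doubleton_eq_iff)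
      then show ?thesis using 2
        by (auto simp: w_def doubleton_eq_iff intro!: derivative_eq_intros)
    next
      case 3
      have "speed (w t) e = 1 / inv_weight_sum spider_E (w t) 0 - exp (- 2 * s t)"
        using 3 e by (simp add: speed_doubleton spider_deg inv_weight_sum_def[of _ _ 3] spider_nbrs w_def doubleton_eq_iff)
      \<comment> \<open>The right side is the derivative of \<open>exp (- 2 * s t)\<close>, with
        \<open>s'\<close> inserted from its equation.\<close>
      also have "\<dots> = exp (- 2 * s t) * (- 2 * (1 / (exp (3 * s t) + 2)))"
      proof -
        have "exp (s t) = exp (- 2 * s t) * exp (3 * s t)" by (simp flip: exp_add)
        then show ?thesis using pos[of "s t"] unfolding D0 by (simp add: field_simps)
      qed
      finally show ?thesis using 3
        by (auto simp: w_def doubleton_eq_iff intro!: derivative_eq_intros s'')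
    next
      case 4
      have "speed (w t) e = exp (s t) * (1 / (exp (3 * s t) + 2))"
        using 4 e D0[of t] by (simp add: speed_doubleton spider_deg)
      then show ?thesis using 4
        by (auto simp: w_def doubleton_eq_iff intro!: derivative_eq_intros s'')
    next
      case 5
      have "speed (w t) e = exp (s t) * (1 / (exp (3 * s t) + 2))"
        using 5 e D0[of t] by (simp add: speed_doubleton spider_deg)
      then show ?thesis using 5
        by (auto simp: w_def doubleton_eq_iff intro!: derivative_eq_intros s'')
    qed
  qed
  then have "unnormalized_ricci_flow spider_V spider_E (w 0) w"
    unfolding unnormalized_flow_with_rate flow_with_rate_def using metric by blast
  moreover have "filterlim (\<lambda>t. w t {0, 1}) at_top at_top"
    unfolding w_def by (simp add: filterlim_compose[OF exp_at_top lim])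
  ultimately show thesis using that metric by blast
qed

theorem theorem2:
  fixes V :: "'a set" and E :: "'a set set" and w0 :: "'a set \<Rightarrow> real"
  assumes tree: "finite_tree V E"
    and not_star: "\<not> is_star V E"
    and metric: "edge_metric E w0"
  shows
    "(\<forall>w. normalized_ricci_flow V E w0 w \<and> converges_to_constant_curvature E w 0
          \<longrightarrow> caterpillar V E)
     \<and>
     ((\<exists>(V' :: nat set) E' u0 u e.
          caterpillar V' E' \<and> \<not> is_star V' E' \<and> edge_metric E' u0 \<and> e \<in> E' \<and>
          unnormalized_ricci_flow V' E' u0 u \<and> ((\<lambda>t. u t e) \<longlongrightarrow> 0) at_top)
      \<and> (\<exists>(V' :: nat set) E' u0 u e.
          caterpillar V' E' \<and> \<not> is_star V' E' \<and> edge_metric E' u0 \<and> e \<in> E' \<and>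
          unnormalized_ricci_flow V' E' u0 u \<and> filterlim (\<lambda>t. u t e) at_top at_top)
      \<and> (\<exists>(V' :: nat set) E' u0 u e l.
          caterpillar V' E' \<and> \<not> is_star V' E' \<and> edge_metric E' u0 \<and> e \<in> E' \<and>
          unnormalized_ricci_flow V' E' u0 u \<and> l > 0 \<and> ((\<lambda>t. u t e) \<longlongrightarrow> l) at_top)
      \<and> (\<exists>(V' :: nat set) E' u0 v0 u v e l m.
          caterpillar V' E' \<and> \<not> is_star V' E' \<and>
          edge_metric E' u0 \<and> edge_metric E' v0 \<and> e \<in> E' \<and>
          unnormalized_ricci_flow V' E' u0 u \<and> unnormalized_ricci_flow V' E' v0 v \<and>
          l > 0 \<and> m > 0 \<and> l \<noteq> m \<and>
          ((\<lambda>t. u t e) \<longlongrightarrow> l) at_top \<and> ((\<lambda>t. v t e) \<longlongrightarrow> m) at_top)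
      \<and> (caterpillar V E \<longrightarrow>
          (\<forall>w e. normalized_ricci_flow V E w0 w \<and> leaf_edge E e
             \<longrightarrow> ((\<lambda>t. w t e) \<longlongrightarrow> 0) at_top)))
     \<and>
     (\<not> caterpillar V E \<longrightarrow>
        (\<forall>w. unnormalized_ricci_flow V E w0 w \<longrightarrow>
           (\<exists>e\<in>E. strict_mono_on {0..} (\<lambda>t. w t e) \<and> filterlim (\<lambda>t. w t e) at_top at_top)))"
proof -
  interpret tree_graph V E by unfold_locales (rule tree)
  \<comment> \<open>\<open>l = 1\<close> serves for the limit zero (leaf edge) and a positive limit
    (middle edge); comparing \<open>l = 1\<close> with \<open>l = 2\<close> shows the influence of
    the initial metric.\<close>
  define w4 :: "real \<Rightarrow> real \<Rightarrow> nat set \<Rightarrow> real" where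
    "w4 = (\<lambda>l t e. if e = {1, 2} then l else exp (- t))"
  have w4: "edge_metric path4_E (w4 l 0)" "unnormalized_ricci_flow path4_V path4_E (w4 l 0) (w4 l)"
    if "l > 0" for l
    using path4_flow[OF that] by (simp_all add: w4_def)
  have w4_inner: "((\<lambda>t. w4 l t {1, 2}) \<longlongrightarrow> l) at_top" for l
    by (simp add: w4_def)
  have "((\<lambda>t::real. exp (- t)) \<longlongrightarrow> 0) at_top"
    by (rule filterlim_compose[OF exp_at_bot filterlim_uminus_at_bot_at_top])
  then have w4_leaf: "((\<lambda>t. w4 1 t {0, 1}) \<longlongrightarrow> 0) at_top"
    by (simp add: w4_def doubleton_eq_iff)
  have w4_E: "{1, 2} \<in> path4_E" "{0, 1} \<in> path4_E" by (simp_all add: path4_E_def)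
  obtain ws where ws: "edge_metric spider_E (ws 0)"
      "unnormalized_ricci_flow spider_V spider_E (ws 0) ws"
      "filterlim (\<lambda>t. ws t {0, 1}) at_top at_top"
    by (rule spider_flow)
  have ws_E: "{0, 1} \<in> spider_E" by (simp add: spider_E_def)
  note path4 = path4_caterpillar path4_not_star
  note spider = spider_caterpillar spider_not_star
  show ?thesis
  proof (intro conjI)
    show "\<forall>w. normalized_ricci_flow V E w0 w \<and> converges_to_constant_curvature E w 0
          \<longrightarrow> caterpillar V E"
      using zero_curvature_caterpillar[OF not_star] by blast
    show "\<exists>(V' :: nat set) E' u0 u e.
          caterpillar V' E' \<and> \<not> is_star V' E' \<and> edge_metric E' u0 \<and> e \<in> E' \<and>
          unnormalized_ricci_flow V' E' u0 u \<and> ((\<lambda>t. u t e) \<longlongrightarrow> 0) at_top"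
      by (intro exI conjI) (rule path4 w4[OF zero_less_one] w4_E w4_leaf)+
    show "\<exists>(V' :: nat set) E' u0 u e.
          caterpillar V' E' \<and> \<not> is_star V' E' \<and> edge_metric E' u0 \<and> e \<in> E' \<and>
          unnormalized_ricci_flow V' E' u0 u \<and> filterlim (\<lambda>t. u t e) at_top at_top"
      by (intro exI conjI) (rule spider ws ws_E)+
    show "\<exists>(V' :: nat set) E' u0 u e l.
          caterpillar V' E' \<and> \<not> is_star V' E' \<and> edge_metric E' u0 \<and> e \<in> E' \<and>
          unnormalized_ricci_flow V' E' u0 u \<and> l > 0 \<and> ((\<lambda>t. u t e) \<longlongrightarrow> l) at_top"
      using path4 w4[of 1] w4_E(1) w4_inner[of 1] zero_less_one by metis
    show "\<exists>(V' :: nat set) E' u0 v0 u v e l m.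
          caterpillar V' E' \<and> \<not> is_star V' E' \<and>
          edge_metric E' u0 \<and> edge_metric E' v0 \<and> e \<in> E' \<and>
          unnormalized_ricci_flow V' E' u0 u \<and> unnormalized_ricci_flow V' E' v0 v \<and>
          l > 0 \<and> m > 0 \<and> l \<noteq> m \<and>
          ((\<lambda>t. u t e) \<longlongrightarrow> l) at_top \<and> ((\<lambda>t. v t e) \<longlongrightarrow> m) at_top"
      using path4 w4[of 1] w4[of 2] w4_E(1) w4_inner[of 1] w4_inner[of 2]
      by (intro exI[of _ path4_V] exI[of _ path4_E] exI[of _ "w4 1 0"] exI[of _ "w4 2 0"]
          exI[of _ "w4 1"] exI[of _ "w4 2"] exI[of _ "{1, 2}"] exI[of _ 1] exI[of _ 2]) simp
    show "caterpillar V E \<longrightarrow>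
          (\<forall>w e. normalized_ricci_flow V E w0 w \<and> leaf_edge E e
             \<longrightarrow> ((\<lambda>t. w t e) \<longlongrightarrow> 0) at_top)"
      using caterpillar_leaf_to_zero[OF not_star _ metric] by blast
    show "\<not> caterpillar V E \<longrightarrow>
        (\<forall>w. unnormalized_ricci_flow V E w0 w \<longrightarrow>
           (\<exists>e\<in>E. strict_mono_on {0..} (\<lambda>t. w t e) \<and> filterlim (\<lambda>t. w t e) at_top at_top))"
    proof (intro impI allI)
      fix w assume "\<not> caterpillar V E" and flow: "unnormalized_ricci_flow V E w0 w"
      then obtain c where "\<not> card (inner_nbrs c) \<le> 2"
        using caterpillarI[OF not_star] by blast
      then have "card (inner_nbrs c) \<ge> 3" by simp
      moreover have "flow_with_rate (\<lambda>t. 0) w"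
        using flow by (simp add: unnormalized_flow_with_rate)
      ultimately show "\<exists>e\<in>E. strict_mono_on {0..} (\<lambda>t. w t e) \<and> filterlim (\<lambda>t. w t e) at_top at_top"
        by (rule non_caterpillar_edge_to_infinity[rotated])
    qed
  qed
qed

end
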